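(* Let $k$ be a field, $S=k[x_1,\dots,x_n]$, let $I\subset (x_1,\dots,x_n)^2$ be a monomial ideal and $R=S/I$. Let $1\le p\le n$, let $i_1,\dots,i_p\in\{1,\dots,n\}$ be distinct indices, and let $u$ be a monomial of $S$ such that $\bar u\, e_{i_1}\wedge\dots\wedge e_{i_p}$ is a cycle in the Koszul complex $K^R$. Then $\bar u\, e_{i_1}\wedge\dots\wedge e_{i_p}$ is a boundary in $K^R$ if and only if $u$ is contained in the boundary ideal $B_I^{n,\{i_1,\dots,i_p\}}$.
   Context: Koszul complex: $K^R$ is the Koszul complex of $R$ with respect to $x_1,\dots,x_n$: $K^R_p=\bigwedge^p R^n$, where $R^n$ has basis $e_1,\dots,e_n$. For $\sigma=\{\sigma_1<\dots<\sigma_p\}\subset[n]=\{1,\dots,n\}$ put $e_\sigma=e_{\sigma_1}\wedge\dots\wedge e_{\sigma_p}$; the differential is $\partial(\bar f e_\sigma)=\sum_{j}\operatorname{sgn}(\sigma,\sigma_j)\,\overline{x_{\sigma_j}f}\,e_{\sigma\setminus\sigma_j}$, where $\bar g$ is the image in $R$ of $g\in S$ and $\operatorname{sgn}(\sigma,\sigma_j)=(-1)^{\#\{s\in\sigma:\,s<\sigma_j\}}$. Boundary ideal: let $\binom{[n]}{p}$ be the set of $p$-element subsets of $[n]$. For $1\le p<n$ let $M(n,p)$ be the matrix over $k$ with rows indexed by $\binom{[n]}{p}$ and columns indexed by $\binom{[n]}{p+1}$, with $(\sigma,\tau)$ entry equal to $0$ if $\sigma\not\subset\tau$ and to $\operatorname{sgn}(\tau,\tau\setminus\sigma)$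 if $\sigma\subset\tau$ (here $\tau\setminus\sigma$ is identified with its unique element). Let $\mathcal C^n_p[k]$ be the collection of all $C\subset\binom{[n]}{p}$ such that the rows of $M(n,p)$ indexed by $C$ form a minimal linearly dependent set over $k$. For $A\subset[n]$ put $x_A=\prod_{a\in A}x_a$. For $\sigma,\sigma'\in\binom{[n]}{p}$ put $I^\sigma_{\sigma'}=x_{\sigma'\setminus\sigma}\,[I:x_{\sigma\setminus\sigma'}]$. For $\sigma\in\binom{[n]}{p}$ with $1\le p<n$ the boundary ideal is $B_I^{n,\sigma}=\bigcap_{C\in\mathcal C^n_p[k],\ \sigma\in C}\ \sum_{\sigma'\in C}I^\sigma_{\sigma'}$, and $B_I^{n,[n]}=I$. *)

theory Defs
  imports
    "HOL-Library.Poly_Mapping"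
    "HOL-Algebra.QuotRing"
    "HOL-Algebra.Ideal_Product"
begin

section \<open>The polynomial ring and monomial ideals\<close>

text \<open>Polynomials with coefficients in \<open>'k\<close> in the countably many variables \<open>x\<^sub>0, x\<^sub>1, \<dots>\<close>.
  The inner \<open>nat \<Rightarrow>\<^sub>0 nat\<close> is the exponent vector of a monomial, and the multiplication \<open>(*)\<close> of the
  outer finitely supported functions is the convolution product.\<close>

type_synonym 'k poly_nat = "(nat \<Rightarrow>\<^sub>0 nat) \<Rightarrow>\<^sub>0 'k"

text \<open>\<open>poly_ring n\<close> is $S = k[x_1, \dots, x_n]$, the subring of those polynomials that involve
  only the variables with index in \<open>{1..n}\<close>.\<close>

definition poly_ring :: "nat \<Rightarrow> ('k::field) poly_nat ring" where
  "poly_ring n =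
     \<lparr>carrier = {f. \<forall>m \<in> Poly_Mapping.keys f. Poly_Mapping.keys m \<subseteq> {1..n}},
      mult = (*), one = 1, zero = 0, add = (+)\<rparr>"

definition Var :: "nat \<Rightarrow> ('k::field) poly_nat" where
  "Var i = Poly_Mapping.single (Poly_Mapping.single i 1) 1"

definition monomials :: "nat \<Rightarrow> ('k::field) poly_nat set" where
  "monomials n = {Poly_Mapping.single m 1 |m. Poly_Mapping.keys m \<subseteq> {1..n}}"

definition monomial_ideal :: "nat \<Rightarrow> ('k::field) poly_nat set \<Rightarrow> bool" where
  "monomial_ideal n I \<longleftrightarrow> (\<exists>M \<subseteq> monomials n. I = genideal (poly_ring n) M)"

definition irrelevant_ideal :: "nat \<Rightarrow> ('k::field) poly_nat set" where
  "irrelevant_ideal n = genideal (poly_ring n) (Var ` {1..n})"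

section \<open>The Koszul complex\<close>

definition binom :: "nat \<Rightarrow> nat \<Rightarrow> nat set set" where
  "binom n p = {\<sigma>. \<sigma> \<subseteq> {1..n} \<and> card \<sigma> = p}"

text \<open>\<open>sgn_exp \<sigma> s\<close> is the exponent of $-1$ in $\mathrm{sgn}(\sigma,s)$.\<close>

definition sgn_exp :: "nat set \<Rightarrow> nat \<Rightarrow> nat" where
  "sgn_exp \<sigma> s = card {t \<in> \<sigma>. t < s}"

text \<open>Elements of the exterior algebra of $R^n$ are given by their coordinates in the basis
  \<open>e\<^sub>\<sigma>\<close>, \<open>\<sigma> \<subseteq> {1..n}\<close>; those of degree \<open>p\<close> are the functions supported on \<open>binom n p\<close>.\<close>

definition koszul_chains :: "('a, 'b) ring_scheme \<Rightarrow> nat \<Rightarrow> nat \<Rightarrow> (nat set \<Rightarrow> 'a) set" where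
  "koszul_chains R n p =
     {c. (\<forall>\<sigma> \<in> binom n p. c \<sigma> \<in> carrier R) \<and> (\<forall>\<sigma>. \<sigma> \<notin> binom n p \<longrightarrow> c \<sigma> = \<zero>\<^bsub>R\<^esub>)}"

definition ebasis :: "('a, 'b) ring_scheme \<Rightarrow> nat set \<Rightarrow> nat set \<Rightarrow> 'a" where
  "ebasis R \<sigma> = (\<lambda>\<rho>. if \<rho> = \<sigma> then \<one>\<^bsub>R\<^esub> else \<zero>\<^bsub>R\<^esub>)"

definition scale :: "('a, 'b) ring_scheme \<Rightarrow> 'a \<Rightarrow> (nat set \<Rightarrow> 'a) \<Rightarrow> nat set \<Rightarrow> 'a" where
  "scale R a c = (\<lambda>\<rho>. a \<otimes>\<^bsub>R\<^esub> c \<rho>)"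

definition neg_one_pow :: "('a, 'b) ring_scheme \<Rightarrow> nat \<Rightarrow> 'a" where
  "neg_one_pow R k = (\<ominus>\<^bsub>R\<^esub> \<one>\<^bsub>R\<^esub>) [^]\<^bsub>R\<^esub> k"

text \<open>The exterior product is the bilinear extension of
  $e_\sigma \wedge e_\tau = (-1)^{\#\{(s,t) \in \sigma\times\tau :\, t < s\}} e_{\sigma\cup\tau}$ for
  disjoint $\sigma,\tau$, and $e_\sigma \wedge e_\tau = 0$ otherwise.\<close>

definition wedge_basis :: "('a, 'b) ring_scheme \<Rightarrow> nat set \<Rightarrow> nat set \<Rightarrow> nat set \<Rightarrow> 'a" where
  "wedge_basis R \<sigma> \<tau> =
     (if \<sigma> \<inter> \<tau> = {}
      then scale R (neg_one_pow R (card {(s, t). s \<in> \<sigma> \<and> t \<in> \<tau> \<and> t < s})) (ebasis R (\<sigma> \<union> \<tau>))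
      else (\<lambda>\<rho>. \<zero>\<^bsub>R\<^esub>))"

definition wedge ::
  "('a, 'b) ring_scheme \<Rightarrow> nat \<Rightarrow> (nat set \<Rightarrow> 'a) \<Rightarrow> (nat set \<Rightarrow> 'a) \<Rightarrow> nat set \<Rightarrow> 'a" where
  "wedge R n a b =
     (\<lambda>\<rho>. \<Oplus>\<^bsub>R\<^esub>\<sigma> \<in> Pow {1..n}. \<Oplus>\<^bsub>R\<^esub>\<tau> \<in> Pow {1..n}.
        (a \<sigma> \<otimes>\<^bsub>R\<^esub> b \<tau>) \<otimes>\<^bsub>R\<^esub> wedge_basis R \<sigma> \<tau> \<rho>)"

text \<open>\<open>wedge_list R n [i\<^sub>1, \<dots>, i\<^sub>p]\<close> is $e_{i_1} \wedge \dots \wedge e_{i_p}$; the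
  indices need not be increasing.\<close>

definition wedge_list :: "('a, 'b) ring_scheme \<Rightarrow> nat \<Rightarrow> nat list \<Rightarrow> nat set \<Rightarrow> 'a" where
  "wedge_list R n js = foldr (\<lambda>j. wedge R n (ebasis R {j})) js (ebasis R {})"

text \<open>The differential of degree \<open>p\<close> of the Koszul complex of \<open>R\<close> with respect to the elements
  \<open>x 1, \<dots>, x n\<close>: the additive extension of
  $\partial (f e_\sigma) = \sum_{s\in\sigma} \mathrm{sgn}(\sigma,s)\, x_s f\, e_{\sigma\setminus s}$.\<close>

definition koszul_diff ::
  "('a, 'b) ring_scheme \<Rightarrow> (nat \<Rightarrow> 'a) \<Rightarrow> nat \<Rightarrow> nat \<Rightarrow> (nat set \<Rightarrow> 'a) \<Rightarrow> nat set \<Rightarrow> 'a" where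
  "koszul_diff R x n p c =
     (\<lambda>\<rho>. \<Oplus>\<^bsub>R\<^esub>\<sigma> \<in> binom n p. \<Oplus>\<^bsub>R\<^esub>s \<in> \<sigma>.
        (neg_one_pow R (sgn_exp \<sigma> s) \<otimes>\<^bsub>R\<^esub> (x s \<otimes>\<^bsub>R\<^esub> c \<sigma>)) \<otimes>\<^bsub>R\<^esub> ebasis R (\<sigma> - {s}) \<rho>)"

definition koszul_cycles ::
  "('a, 'b) ring_scheme \<Rightarrow> (nat \<Rightarrow> 'a) \<Rightarrow> nat \<Rightarrow> nat \<Rightarrow> (nat set \<Rightarrow> 'a) set" where
  "koszul_cycles R x n p = {c \<in> koszul_chains R n p. koszul_diff R x n p c = (\<lambda>\<rho>. \<zero>\<^bsub>R\<^esub>)}"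

definition koszul_boundaries ::
  "('a, 'b) ring_scheme \<Rightarrow> (nat \<Rightarrow> 'a) \<Rightarrow> nat \<Rightarrow> nat \<Rightarrow> (nat set \<Rightarrow> 'a) set" where
  "koszul_boundaries R x n p = koszul_diff R x n (Suc p) ` koszul_chains R n (Suc p)"

text \<open>\<open>residue n I f\<close> is the image $\bar f$ of $f \in S$ in $R = S/I$.\<close>

definition residue :: "nat \<Rightarrow> ('k::field) poly_nat set \<Rightarrow> 'k poly_nat \<Rightarrow> 'k poly_nat set" where
  "residue n I f = I +>\<^bsub>poly_ring n\<^esub> f"

section \<open>The boundary ideal\<close>

text \<open>The entries of the matrix $M(n,p)$, for $\sigma$ of size $p$ and $\tau$ of size $p+1$.\<close>

definition M_entry :: "nat set \<Rightarrow> nat set \<Rightarrow> 'k::field" where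
  "M_entry \<sigma> \<tau> = (if \<sigma> \<subseteq> \<tau> then (- 1) ^ sgn_exp \<tau> (the_elem (\<tau> - \<sigma>)) else 0)"

text \<open>Linear dependence is that of the family of rows indexed by \<open>C\<close>, not of the set of row
  vectors: for \<open>p = n - 1\<close> different indices may have equal rows.\<close>

definition rows_dependent :: "'k::field itself \<Rightarrow> nat \<Rightarrow> nat \<Rightarrow> nat set set \<Rightarrow> bool" where
  "rows_dependent _ n p C \<longleftrightarrow>
     (\<exists>a :: nat set \<Rightarrow> 'k. (\<exists>\<sigma> \<in> C. a \<sigma> \<noteq> 0) \<and>
        (\<forall>\<tau> \<in> binom n (p + 1). (\<Sum>\<sigma> \<in> C. a \<sigma> * M_entry \<sigma> \<tau>) = 0))"

definition circuits :: "'k::field itself \<Rightarrow> nat \<Rightarrow> nat \<Rightarrow> nat set set set" where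
  "circuits K n p =
     {C. C \<subseteq> binom n p \<and> rows_dependent K n p C \<and> (\<forall>D. D \<subset> C \<longrightarrow> \<not> rows_dependent K n p D)}"

definition Var_prod :: "nat set \<Rightarrow> ('k::field) poly_nat" where
  "Var_prod A = (\<Prod>a \<in> A. Var a)"

definition colon :: "nat \<Rightarrow> ('k::field) poly_nat set \<Rightarrow> 'k poly_nat \<Rightarrow> 'k poly_nat set" where
  "colon n I g = {f \<in> carrier (poly_ring n). f * g \<in> I}"

text \<open>\<open>shifted_colon n I \<sigma> \<sigma>'\<close> is $I^\sigma_{\sigma'}$.\<close>

definition shifted_colon ::
  "nat \<Rightarrow> ('k::field) poly_nat set \<Rightarrow> nat set \<Rightarrow> nat set \<Rightarrow> 'k poly_nat set" where
  "shifted_colon n I \<sigma> \<sigma>' = (\<lambda>f. Var_prod (\<sigma>' - \<sigma>) * f) ` colon n I (Var_prod (\<sigma> - \<sigma>'))"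

definition ideal_sum :: "'i set \<Rightarrow> ('i \<Rightarrow> ('k::field) poly_nat set) \<Rightarrow> 'k poly_nat set" where
  "ideal_sum C J = {(\<Sum>i \<in> C. f i) |f. \<forall>i \<in> C. f i \<in> J i}"

text \<open>Here \<open>\<sigma>\<close> is a nonempty subset of \<open>{1..n}\<close> and $p$ is its cardinality.\<close>

definition boundary_ideal ::
  "nat \<Rightarrow> ('k::field) poly_nat set \<Rightarrow> nat set \<Rightarrow> 'k poly_nat set" where
  "boundary_ideal n I \<sigma> =
     (if \<sigma> = {1..n} then I
      else {f \<in> carrier (poly_ring n).
              \<forall>C \<in> circuits TYPE('k) n (card \<sigma>). \<sigma> \<in> C \<longrightarrow>
                f \<in> ideal_sum C (shifted_colon n I \<sigma>)})"

end

(*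
  Write u = x^m and sigma = {i_1, ..., i_p}. Comparing coefficients in the multidegree a = m + e_sigma
  turns the boundary condition into a linear system over k: find w on the (p+1)-subsets of
  A = supp(a) with sum_tau w_tau M(rho,tau) = [rho = sigma] for those p-subsets rho of A for which
  x^(a - e_rho) is not in I. By the Fredholm alternative it is unsolvable iff there is a linear
  dependency, nonzero at sigma, among the rows rho restricted to the columns inside A. Such a
  dependency is a cocycle of the simplex on A, hence a coboundary, and extending the cobounding
  cochain by zero gives a dependency of the full rows of M(n,p), which contains a circuit through
  sigma. Finally, as all ideals involved are monomial, u lies in the sum over a circuit C
  iff x^(a - e_rho) is a monomial of I for some rho in C.
*)

theory Submission
  imports Defs
begin

section \<open>Circuits and solvability of the coefficient system\<close>


text \<open>The obstacle is a mismatch of columns: the system in multidegree a sees only the columns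
  inside A, whereas circuits are defined by all columns of M(n,p), and a dependency of truncated
  rows need not be one of full rows. Acyclicity of the simplex on A bridges the gap. A cochain that
  cobounds the truncated dependency has a coboundary on every finite vertex set, and that coboundary
  is a cocycle with no further condition to check. It agrees with the given dependency on subsets of
  A; new nonzero entries appear only at sets rho not contained in A. These do no harm: e_rho then
  fails to divide x^a, so rho can never witness that u lies in the sum over a circuit. This explains
  the side condition \<open>\<rho> \<subseteq> A\<close> in the circuit criterion. The assumption p
  >= 1 makes A nonempty, so that there is a vertex to cone over. For p = n there are no columns at
  all, and the convention that the boundary ideal is I has to be matched separately.\<close>

lemma fredholm_alternative:
  fixes M :: "'a \<Rightarrow> 'b \<Rightarrow> 'k::field"
  assumes "finite T" "finite G"
  shows "(\<exists>w. \<forall>r\<in>G. (\<Sum>t\<in>T. w t * M r t) = b r) \<or>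
    (\<exists>l. (\<forall>t\<in>T. (\<Sum>r\<in>G. l r * M r t) = 0) \<and> (\<Sum>r\<in>G. l r * b r) \<noteq> 0)"
  using assms
proof (induction T arbitrary: G M b rule: finite_induct)
  case empty
  show ?case
  proof (cases "\<forall>r\<in>G. b r = 0")
    case False
    then obtain r where r: "r \<in> G" "b r \<noteq> 0" by blast
    \<comment> \<open>With no unknowns left, the indicator of a row with nonzero right-hand side
      certifies unsolvability.\<close>
    have "(\<Sum>s\<in>G. (if s = r then 1 else 0) * b s) = (\<Sum>s\<in>G. if s = r then b s else 0)"
      by (rule sum.cong) auto
    also have "\<dots> = b r" using r empty by simp
    finally show ?thesis using r by (intro disjI2 exI[of _ "\<lambda>s. if s = r then 1 else 0"]) auto
  qed simp
next
  case (insert t0 T)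
  show ?case
  proof (cases "\<forall>r\<in>G. M r t0 = 0")
    case True
    from insert.IH[OF insert.prems, of M b] show ?thesis
    proof (elim disjE exE conjE)
      fix w assume "\<forall>r\<in>G. (\<Sum>t\<in>T. w t * M r t) = b r"
      then have "\<forall>r\<in>G. (\<Sum>t\<in>insert t0 T. w t * M r t) = b r"
        using insert.hyps True by simp
      then show ?thesis by blast
    next
      fix l assume "\<forall>t\<in>T. (\<Sum>r\<in>G. l r * M r t) = 0" and b: "(\<Sum>r\<in>G. l r * b r) \<noteq> 0"
      then have "\<forall>t\<in>insert t0 T. (\<Sum>r\<in>G. l r * M r t) = 0"
        using True by simp
      then show ?thesis using b by blast
    qed
  next
    case False
    then obtain r0 where r0: "r0 \<in> G" "M r0 t0 \<noteq> 0" by blast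
    \<comment> \<open>One step of Gaussian elimination: the pivot row \<open>r0\<close> clears
      column \<open>t0\<close> from the other rows, leaving a system in the unknowns
      \<open>T\<close>.\<close>
    define q where "q r = M r t0 / M r0 t0" for r
    define M' where "M' r t = M r t - q r * M r0 t" for r t
    define b' where "b' r = b r - q r * b r0" for r
    have fG: "finite (G - {r0})" using insert.prems by simp
    have G: "G = insert r0 (G - {r0})" using r0 by blast
    from insert.IH[OF fG, of M' b'] show ?thesis
    proof (elim disjE exE conjE)
      fix w assume w: "\<forall>r\<in>G - {r0}. (\<Sum>t\<in>T. w t * M' r t) = b' r"
      \<comment> \<open>The pivot equation is solved for the remaining unknown
        \<open>t0\<close>.\<close>
      define w' where "w' = w(t0 := (b r0 - (\<Sum>t\<in>T. w t * M r0 t)) / M r0 t0)"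
      have split: "(\<Sum>t\<in>insert t0 T. w' t * M r t)
          = (b r0 - (\<Sum>t\<in>T. w t * M r0 t)) * q r + (\<Sum>t\<in>T. w t * M r t)" for r
      proof -
        have "(\<Sum>t\<in>T. w' t * M r t) = (\<Sum>t\<in>T. w t * M r t)"
          using insert.hyps by (intro sum.cong) (auto simp: w'_def)
        then show ?thesis using insert.hyps by (simp add: w'_def q_def)
      qed
      have "(\<Sum>t\<in>insert t0 T. w' t * M r t) = b r" if r: "r \<in> G" for r
      proof (cases "r = r0")
        case True
        then show ?thesis unfolding split using r0 by (simp add: q_def)
      next
        case False
        have "(\<Sum>t\<in>T. w t * M' r t) = (\<Sum>t\<in>T. w t * M r t) - q r * (\<Sum>t\<in>T. w t * M r0 t)"
          unfolding M'_def sum_distrib_left sum_subtractf[symmetric]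
          by (intro sum.cong) (auto simp: algebra_simps)
        moreover have "(\<Sum>t\<in>T. w t * M' r t) = b r - q r * b r0"
          using w r False by (simp add: b'_def)
        ultimately show ?thesis unfolding split by (simp add: algebra_simps)
      qed
      then show ?thesis by blast
    next
      fix l assume l: "\<forall>t\<in>T. (\<Sum>r\<in>G - {r0}. l r * M' r t) = 0"
        and lb: "(\<Sum>r\<in>G - {r0}. l r * b' r) \<noteq> 0"
      \<comment> \<open>The multiplier of the pivot row undoes the elimination: a combination of
        reduced rows is rewritten as one of the original rows, for the columns and the right-hand
        side alike.\<close>
      define l' where "l' = l(r0 := - (\<Sum>r\<in>G - {r0}. l r * q r))"
      have split: "(\<Sum>r\<in>G. l' r * f r) = (\<Sum>r\<in>G - {r0}. l r * (f r - q r * f r0))" for f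
      proof -
        have "(\<Sum>r\<in>G. l' r * f r) = l' r0 * f r0 + (\<Sum>r\<in>G - {r0}. l' r * f r)"
          by (subst G, subst sum.insert) (use fG in auto)
        also have "(\<Sum>r\<in>G - {r0}. l' r * f r) = (\<Sum>r\<in>G - {r0}. l r * f r)"
          by (intro sum.cong) (auto simp: l'_def)
        finally have "(\<Sum>r\<in>G. l' r * f r) = l' r0 * f r0 + (\<Sum>r\<in>G - {r0}. l r * f r)" .
        moreover have "(\<Sum>r\<in>G - {r0}. l r * (f r - q r * f r0))
            = (\<Sum>r\<in>G - {r0}. l r * f r) - (\<Sum>r\<in>G - {r0}. l r * q r) * f r0"
          by (simp add: right_diff_distrib sum_subtractf sum_distrib_right mult.assoc)
        ultimately show ?thesis by (simp add: l'_def)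
      qed
      have "(\<Sum>r\<in>G. l' r * M r t) = 0" if "t \<in> insert t0 T" for t
      proof (cases "t = t0")
        case True
        then show ?thesis using r0 unfolding split by (simp add: q_def)
      next
        case False
        then show ?thesis using l that unfolding split M'_def by simp
      qed
      moreover have "(\<Sum>r\<in>G. l' r * b r) \<noteq> 0"
        using lb unfolding split b'_def .
      ultimately show ?thesis by blast
    qed
  qed
qed

section \<open>Dependencies and circuits among the rows of M(n,p)\<close>

lemma finite_binom [simp]: "finite (binom n p)"
  by (rule finite_subset[of _ "Pow {1..n}"]) (auto simp: binom_def)

lemma binom_finite: "\<sigma> \<in> binom n p \<Longrightarrow> finite \<sigma>"
  unfolding binom_def using finite_subset[OF _ finite_atLeastAtMost] by blast

text \<open>Minimal support does the work: among the dependencies nonzero at \<sigma> whose support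
  lies in that of \<open>z\<close>, one with the fewest nonzero entries is supported on a
  circuit.\<close>

lemma circuit_exists:
  fixes z :: "nat set \<Rightarrow> 'k::field"
  assumes z: "\<forall>\<tau>\<in>binom n (p + 1). (\<Sum>\<rho>\<in>binom n p. z \<rho> * M_entry \<rho> \<tau>) = 0"
    and \<sigma>: "\<sigma> \<in> binom n p" "z \<sigma> \<noteq> 0"
  obtains C where "C \<in> circuits TYPE('k) n p" "\<sigma> \<in> C" "\<And>\<rho>. \<rho> \<in> C \<Longrightarrow> z \<rho> \<noteq> 0"
proof -
  define S where "S a = {\<rho>\<in>binom n p. a \<rho> \<noteq> 0}" for a :: "nat set \<Rightarrow> 'k"
  define dep where "dep a \<longleftrightarrow> (\<forall>\<tau>\<in>binom n (p + 1). (\<Sum>\<rho>\<in>binom n p. a \<rho> * M_entry \<rho> \<tau>) = 0)"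
    for a :: "nat set \<Rightarrow> 'k"
  define P where "P a \<longleftrightarrow> dep a \<and> a \<sigma> \<noteq> 0 \<and> S a \<subseteq> S z" for a
  have fS: "finite (S a)" for a by (simp add: S_def)
  have "P z" using assms by (auto simp: P_def dep_def)
  then obtain a where a: "P a" and min: "\<And>b. P b \<Longrightarrow> card (S a) \<le> card (S b)"
    using ex_has_least_nat[of P z "\<lambda>b. card (S b)"] by blast
  have dep_sum: "(\<Sum>\<rho>\<in>S a. a \<rho> * M_entry \<rho> \<tau>) = (\<Sum>\<rho>\<in>binom n p. a \<rho> * M_entry \<rho> \<tau>)" for \<tau>
    by (rule sum.mono_neutral_left) (auto simp: S_def)
  have C: "S a \<in> circuits TYPE('k) n p"
    unfolding circuits_def
  proof (intro CollectI conjI allI impI)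
    show "S a \<subseteq> binom n p" by (auto simp: S_def)
    show "rows_dependent TYPE('k) n p (S a)"
      unfolding rows_dependent_def
    proof (intro exI[of _ a] conjI ballI)
      show "\<exists>\<rho>\<in>S a. a \<rho> \<noteq> 0" using a \<sigma> by (auto simp: P_def S_def)
      show "(\<Sum>\<rho>\<in>S a. a \<rho> * M_entry \<rho> \<tau>) = 0" if "\<tau> \<in> binom n (p + 1)" for \<tau>
        unfolding dep_sum using a that by (simp add: P_def dep_def)
    qed
    fix D assume D: "D \<subset> S a"
    show "\<not> rows_dependent TYPE('k) n p D"
    proof
      assume "rows_dependent TYPE('k) n p D"
      then obtain d0 :: "nat set \<Rightarrow> 'k" and \<rho>0 where d0: "\<rho>0 \<in> D" "d0 \<rho>0 \<noteq> 0"
        "\<And>\<tau>. \<tau> \<in> binom n (p + 1) \<Longrightarrow> (\<Sum>\<sigma>\<in>D. d0 \<sigma> * M_entry \<sigma> \<tau>) = 0"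
        unfolding rows_dependent_def by blast
      define d where "d \<rho> = (if \<rho> \<in> D then d0 \<rho> else 0)" for \<rho>
      have D_sub: "D \<subseteq> binom n p" using D by (auto simp: S_def)
      have dd: "(\<Sum>\<rho>\<in>binom n p. d \<rho> * M_entry \<rho> \<tau>) = 0" if "\<tau> \<in> binom n (p + 1)" for \<tau>
      proof -
        have "(\<Sum>\<rho>\<in>binom n p. d \<rho> * M_entry \<rho> \<tau>) = (\<Sum>\<rho>\<in>D. d0 \<rho> * M_entry \<rho> \<tau>)"
          using D_sub by (intro sum.mono_neutral_cong_right) (auto simp: d_def)
        then show ?thesis using d0 that by simp
      qed
      have Sd: "S d \<subseteq> D" by (auto simp: S_def d_def)
      show False
      proof (cases "d \<sigma> = 0")
        case False
        moreover have "S d \<subseteq> S z" using Sd D a unfolding P_def by blast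
        ultimately have "P d" using dd by (simp add: P_def dep_def)
        moreover have "card (S d) < card (S a)"
          using psubset_card_mono[OF fS] Sd D by (meson subset_psubset_trans)
        ultimately show False using min[of d] by simp
      next
        case True
        \<comment> \<open>The factor is chosen to cancel the entry at \<open>\<rho>0\<close>. As
          \<open>d\<close> vanishes at \<sigma>, the entry of \<open>a\<close> there survives, so
          \<open>b\<close> competes with \<open>a\<close> on a smaller support.\<close>
        define q where "q = a \<rho>0 / d \<rho>0"
        define b where "b \<rho> = a \<rho> - q * d \<rho>" for \<rho>
        have d\<rho>: "d \<rho>0 \<noteq> 0" using d0 by (simp add: d_def)
        have Sb: "S b \<subset> S a"
        proof -
          have "S b \<subseteq> S a" using Sd D by (auto simp: S_def b_def d_def)
          moreover have "b \<rho>0 = 0" using d\<rho> by (simp add: b_def q_def)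
          moreover have "\<rho>0 \<in> S a" using d0 D by auto
          ultimately show ?thesis by (auto simp: S_def)
        qed
        have "(\<Sum>\<rho>\<in>binom n p. b \<rho> * M_entry \<rho> \<tau>)
            = (\<Sum>\<rho>\<in>binom n p. a \<rho> * M_entry \<rho> \<tau>) - q * (\<Sum>\<rho>\<in>binom n p. d \<rho> * M_entry \<rho> \<tau>)" for \<tau>
          by (simp add: b_def algebra_simps sum_subtractf sum_distrib_left)
        then have "dep b" using a dd by (simp add: P_def dep_def)
        moreover have "b \<sigma> \<noteq> 0" using a True by (simp add: P_def b_def)
        ultimately have "P b" using Sb a unfolding P_def by blast
        moreover have "card (S b) < card (S a)" by (rule psubset_card_mono[OF fS Sb])
        ultimately show False using min[of b] by simp
      qed
    qed
  qed
  show thesis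
    by (rule that[OF C]) (use a \<sigma> in \<open>auto simp: P_def S_def\<close>)
qed

text \<open>With coefficient zero at \<sigma> the set \<open>C - {\<sigma>}\<close> would already be
  dependent, against the minimality of a circuit.\<close>

lemma circuit_coefficients:
  assumes C: "C \<in> circuits TYPE('k::field) n p" and \<sigma>: "\<sigma> \<in> C"
  obtains a :: "nat set \<Rightarrow> 'k::field" where "a \<sigma> \<noteq> 0"
    "\<And>\<tau>. \<tau> \<in> binom n (p + 1) \<Longrightarrow> (\<Sum>\<rho>\<in>C. a \<rho> * M_entry \<rho> \<tau>) = 0"
proof -
  have "C \<subseteq> binom n p" using C by (simp add: circuits_def)
  then have fin: "finite C" by (rule finite_subset) simp
  obtain a :: "nat set \<Rightarrow> 'k" and \<rho>0 where a: "\<rho>0 \<in> C" "a \<rho>0 \<noteq> 0"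
    "\<And>\<tau>. \<tau> \<in> binom n (p + 1) \<Longrightarrow> (\<Sum>\<rho>\<in>C. a \<rho> * M_entry \<rho> \<tau>) = 0"
    using C by (auto simp: circuits_def rows_dependent_def)
  have "a \<sigma> \<noteq> 0"
  proof
    assume z: "a \<sigma> = 0"
    have "(\<Sum>\<rho>\<in>C - {\<sigma>}. a \<rho> * M_entry \<rho> \<tau>) = (\<Sum>\<rho>\<in>C. a \<rho> * M_entry \<rho> \<tau>)" for \<tau>
      using fin z by (intro sum.mono_neutral_left) auto
    then have "rows_dependent TYPE('k) n p (C - {\<sigma>})"
      unfolding rows_dependent_def using a z by (intro exI[of _ a]) auto
    moreover have "C - {\<sigma>} \<subset> C" using \<sigma> by blast
    ultimately show False using C by (auto simp: circuits_def)
  qed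
  then show thesis using a(3) that by blast
qed

section \<open>Augmented simplicial cochains of the full simplex, the empty face included\<close>

definition cob :: "(nat set \<Rightarrow> 'k::field) \<Rightarrow> nat set \<Rightarrow> 'k" where
  "cob w \<tau> = (\<Sum>s\<in>\<tau>. (- 1) ^ sgn_exp \<tau> s * w (\<tau> - {s}))"

text \<open>Column \<tau> is nonzero only at the facets of \<tau>, with the usual incidence signs.
  So linear dependencies of the rows are exactly cocycles, and topology of the simplex becomes
  available.\<close>

lemma sum_M_entry:
  fixes a :: "nat set \<Rightarrow> 'k::field"
  assumes "\<tau> \<in> binom n (p + 1)"
  shows "(\<Sum>\<rho>\<in>binom n p. a \<rho> * M_entry \<rho> \<tau>) = cob a \<tau>"
proof -
  have f: "finite \<tau>" and c: "card \<tau> = p + 1" and sub: "\<tau> \<subseteq> {1..n}"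
    using assms binom_finite[OF assms] by (auto simp: binom_def)
  have inj: "inj_on (\<lambda>s. \<tau> - {s}) \<tau>" by (auto simp: inj_on_def)
  have img: "(\<lambda>s. \<tau> - {s}) ` \<tau> \<subseteq> binom n p" using c f sub by (auto simp: binom_def)
  have "M_entry \<rho> \<tau> = (0::'k)" if "\<rho> \<in> binom n p - (\<lambda>s. \<tau> - {s}) ` \<tau>" for \<rho>
  proof -
    have "\<not> \<rho> \<subseteq> \<tau>"
    proof
      assume s: "\<rho> \<subseteq> \<tau>"
      have "card (\<tau> - \<rho>) = 1" using s c that finite_subset[OF s f] by (auto simp: card_Diff_subset binom_def)
      then obtain x where "\<tau> - \<rho> = {x}" by (auto simp: card_1_singleton_iff)
      then have "\<rho> = \<tau> - {x}" "x \<in> \<tau>" using s by auto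
      then show False using that by blast
    qed
    then show ?thesis by (simp add: M_entry_def)
  qed
  then have "(\<Sum>\<rho>\<in>binom n p. a \<rho> * M_entry \<rho> \<tau>)
      = (\<Sum>\<rho>\<in>(\<lambda>s. \<tau> - {s}) ` \<tau>. a \<rho> * M_entry \<rho> \<tau>)"
    using img by (intro sum.mono_neutral_right) auto
  also have "\<dots> = (\<Sum>s\<in>\<tau>. a (\<tau> - {s}) * M_entry (\<tau> - {s}) \<tau>)"
    by (simp add: sum.reindex[OF inj])
  also have "\<dots> = cob a \<tau>" unfolding cob_def
  proof (rule sum.cong)
    fix s assume "s \<in> \<tau>"
    then have "\<tau> - (\<tau> - {s}) = {s}" by auto
    then show "a (\<tau> - {s}) * M_entry (\<tau> - {s}) \<tau> = (- 1) ^ sgn_exp \<tau> s * a (\<tau> - {s})"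
      by (simp add: M_entry_def)
  qed simp
  finally show ?thesis .
qed

lemma sgn_exp_remove:
  assumes "finite \<tau>" "s \<in> \<tau>"
  shows "sgn_exp \<tau> t = sgn_exp (\<tau> - {s}) t + (if s < t then 1 else 0)"
proof (cases "s < t")
  case True
  have "{r \<in> \<tau>. r < t} = insert s {r \<in> \<tau> - {s}. r < t}" using assms True by auto
  then show ?thesis using assms True by (simp add: sgn_exp_def)
next
  case False
  then have "{r \<in> \<tau>. r < t} = {r \<in> \<tau> - {s}. r < t}" by auto
  then show ?thesis using False by (simp add: sgn_exp_def)
qed

text \<open>Every pair s < t of removed vertices occurs in both orders. Removing s first lowers the
  exponent of t by one, while removing t leaves that of s unchanged, so the two terms
  cancel.\<close>

lemma cob_cob:
  assumes f: "finite \<tau>"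
  shows "cob (cob w) \<tau> = 0"
proof -
  define g where "g = (\<lambda>(s, t). (- 1) ^ sgn_exp \<tau> s * ((- 1) ^ sgn_exp (\<tau> - {s}) t * w (\<tau> - {s} - {t})))"
  define L where "L = {(s, t). s \<in> \<tau> \<and> t \<in> \<tau> \<and> s < t}"
  define U where "U = {(s, t). s \<in> \<tau> \<and> t \<in> \<tau> \<and> t < s}"
  have fL: "finite L" "finite U"
    unfolding L_def U_def by (rule finite_subset[of _ "\<tau> \<times> \<tau>"]; use f in auto)+
  have "cob (cob w) \<tau> = (\<Sum>s\<in>\<tau>. \<Sum>t\<in>\<tau> - {s}. g (s, t))"
    unfolding cob_def g_def by (simp add: sum_distrib_left)
  also have "\<dots> = (\<Sum>x\<in>(SIGMA s:\<tau>. \<tau> - {s}). g x)"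
    using f by (subst sum.Sigma) (auto simp: prod.case_distrib)
  also have "(SIGMA s:\<tau>. \<tau> - {s}) = L \<union> U" by (auto simp: L_def U_def)
  also have "(\<Sum>x\<in>L \<union> U. g x) = (\<Sum>x\<in>L. g x) + (\<Sum>x\<in>U. g x)"
    using fL by (intro sum.union_disjoint) (auto simp: L_def U_def)
  also have "(\<Sum>x\<in>U. g x) = (\<Sum>x\<in>L. g (prod.swap x))"
  proof -
    have "U = prod.swap ` L" by (auto simp: L_def U_def image_iff)
    then show ?thesis by (simp add: sum.reindex)
  qed
  also have "(\<Sum>x\<in>L. g (prod.swap x)) = (\<Sum>x\<in>L. - g x)"
  proof (rule sum.cong)
    fix x assume "x \<in> L"
    then obtain s t where x: "x = (s, t)" "s \<in> \<tau>" "t \<in> \<tau>" "s < t" by (auto simp: L_def)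
    have "\<tau> - {s} - {t} = \<tau> - {t} - {s}" by auto
    then show "g (prod.swap x) = - g x"
      using sgn_exp_remove[OF f x(2), of t] sgn_exp_remove[OF f x(3), of s] x
      by (simp add: g_def)
  qed simp
  finally show ?thesis by (simp add: sum_negf)
qed

text \<open>A simplex with at least one vertex is contractible; this is the explicit contracting
  homotopy for its augmented cochains.\<close>

lemma cocycle_is_coboundary:
  fixes l :: "nat set \<Rightarrow> 'k::field"
  assumes A: "finite A" "A \<noteq> {}"
    and cocycle: "\<And>\<tau>. \<tau> \<subseteq> A \<Longrightarrow> card \<tau> = p + 1 \<Longrightarrow> cob l \<tau> = 0"
  obtains w where "\<And>\<tau>. \<tau> \<subseteq> A \<Longrightarrow> card \<tau> = p \<Longrightarrow> \<tau> \<noteq> {} \<Longrightarrow> cob w \<tau> = l \<tau>"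
proof -
  \<comment> \<open>\<open>w\<close> is the cone over the least vertex, so that no sign enters its definition.\<close>
  define v where "v = Min A"
  have v: "v \<in> A" "\<And>s. s \<in> A \<Longrightarrow> v \<le> s" using A by (auto simp: v_def)
  define w where "w \<rho> = (if v \<in> \<rho> then 0 else l (insert v \<rho>))" for \<rho>
  have "cob w \<tau> = l \<tau>" if \<tau>: "\<tau> \<subseteq> A" "card \<tau> = p" "\<tau> \<noteq> {}" for \<tau>
  proof -
    have f: "finite \<tau>" using \<tau> A finite_subset by blast
    show ?thesis
    proof (cases "v \<in> \<tau>")
      case True
      have "{t \<in> \<tau>. t < v} = {}" using v(2) \<tau>(1) by (auto simp: not_less)
      then have s0: "sgn_exp \<tau> v = 0" by (simp only: sgn_exp_def card.empty)
      \<comment> \<open>Every other facet of \<tau> still contains \<open>v\<close>, where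
        \<open>w\<close> is zero, so one term survives.\<close>
      have "cob w \<tau> = (- 1) ^ sgn_exp \<tau> v * w (\<tau> - {v})
          + (\<Sum>s\<in>\<tau> - {v}. (- 1) ^ sgn_exp \<tau> s * w (\<tau> - {s}))"
        unfolding cob_def using f True by (rule sum.remove)
      also have "(\<Sum>s\<in>\<tau> - {v}. (- 1) ^ sgn_exp \<tau> s * w (\<tau> - {s})) = 0"
        using True by (intro sum.neutral) (auto simp: w_def)
      also have "w (\<tau> - {v}) = l \<tau>" using True by (simp add: w_def insert_absorb)
      finally show ?thesis using s0 by simp
    next
      case False
      let ?T = "insert v \<tau>"
      have "{t \<in> ?T. t < v} = {}" using v(2) \<tau>(1) by (auto simp: not_less)
      then have s0: "sgn_exp ?T v = 0" by (simp only: sgn_exp_def card.empty)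
      \<comment> \<open>The cocycle condition on the cone over \<tau> isolates
        \<open>l \<tau>\<close>. The remaining facets contain \<open>v\<close> and are values of
        \<open>w\<close>; since \<open>v\<close> precedes each s, their exponents are shifted by
        one, which gives the minus sign.\<close>
      have "0 = cob l ?T" using \<tau> v(1) f False by (simp add: cocycle)
      also have "\<dots> = l \<tau> + (\<Sum>s\<in>\<tau>. (- 1) ^ sgn_exp ?T s * l (?T - {s}))"
        unfolding cob_def using f False s0 by simp
      also have "(\<Sum>s\<in>\<tau>. (- 1) ^ sgn_exp ?T s * l (?T - {s})) = (\<Sum>s\<in>\<tau>. - ((- 1) ^ sgn_exp \<tau> s * w (\<tau> - {s})))"
      proof (rule sum.cong)
        fix s assume s: "s \<in> \<tau>"
        then have "v < s" using v(2) \<tau>(1) False by (metis le_neq_implies_less subsetD)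
        then have "sgn_exp ?T s = sgn_exp \<tau> s + 1"
          using sgn_exp_remove[of ?T v s] f False by simp
        moreover have "?T - {s} = insert v (\<tau> - {s})" using s False by auto
        ultimately show "(- 1) ^ sgn_exp ?T s * l (?T - {s}) = - ((- 1) ^ sgn_exp \<tau> s * w (\<tau> - {s}))"
          using False by (simp add: w_def)
      qed simp
      finally show ?thesis by (simp add: cob_def sum_negf)
    qed
  qed
  then show thesis by (rule that)
qed

text \<open>A solution pairs to zero with every dependency of the rows, and conversely an
  obstruction can be extended to a dependency of the full rows. In the application
  \<open>Q \<rho>\<close> says that x^(a - e_rho) lies in I, so that the equation of row \<rho> is
  lost modulo I.\<close>

lemma solvable_iff_circuits:
  assumes p: "1 \<le> p" and \<sigma>: "\<sigma> \<in> binom n p" "\<sigma> \<subseteq> A" and A: "A \<subseteq> {1..n}"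
  shows "(\<exists>w :: nat set \<Rightarrow> 'k::field. (\<forall>\<tau>. \<not> \<tau> \<subseteq> A \<longrightarrow> w \<tau> = 0) \<and>
      (\<forall>\<rho>\<in>binom n p. \<rho> \<subseteq> A \<longrightarrow> \<not> Q \<rho> \<longrightarrow>
        (\<Sum>\<tau>\<in>binom n (p + 1). w \<tau> * M_entry \<rho> \<tau>) = (if \<rho> = \<sigma> then 1 else 0)))
    \<longleftrightarrow> (\<forall>C\<in>circuits TYPE('k) n p. \<sigma> \<in> C \<longrightarrow> (\<exists>\<rho>\<in>C. \<rho> \<subseteq> A \<and> Q \<rho>))"
    (is "?L \<longleftrightarrow> ?R")
proof
  assume ?L
  then obtain w :: "nat set \<Rightarrow> 'k" where w0: "\<forall>\<tau>. \<not> \<tau> \<subseteq> A \<longrightarrow> w \<tau> = 0"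
    and w1: "\<forall>\<rho>\<in>binom n p. \<rho> \<subseteq> A \<longrightarrow> \<not> Q \<rho> \<longrightarrow>
        (\<Sum>\<tau>\<in>binom n (p + 1). w \<tau> * M_entry \<rho> \<tau>) = (if \<rho> = \<sigma> then 1 else 0)"
    by (elim exE conjE) (rule that)
  show ?R
  proof (intro ballI impI)
    fix C assume C: "C \<in> circuits TYPE('k) n p" and \<sigma>C: "\<sigma> \<in> C"
    obtain a :: "nat set \<Rightarrow> 'k" where a: "a \<sigma> \<noteq> 0"
      "\<And>\<tau>. \<tau> \<in> binom n (p + 1) \<Longrightarrow> (\<Sum>\<rho>\<in>C. a \<rho> * M_entry \<rho> \<tau>) = 0"
      using circuit_coefficients[OF C \<sigma>C] by blast
    have Csub: "C \<subseteq> binom n p" using C by (simp add: circuits_def)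
    then have fin: "finite C" by (rule finite_subset) simp
    show "\<exists>\<rho>\<in>C. \<rho> \<subseteq> A \<and> Q \<rho>"
    proof (rule ccontr)
      assume neg: "\<not> (\<exists>\<rho>\<in>C. \<rho> \<subseteq> A \<and> Q \<rho>)"
      \<comment> \<open>If no member of \<open>C\<close> is exempted by \<open>Q\<close>, the
        equations hold on all of \<open>C\<close>: for \<rho> outside \<open>A\<close> both sides
        are zero, because each \<tau> containing \<rho> leaves \<open>A\<close> as well.\<close>
      have v: "(\<Sum>\<tau>\<in>binom n (p + 1). w \<tau> * M_entry \<rho> \<tau>) = (if \<rho> = \<sigma> then 1 else 0)"
        if "\<rho> \<in> C" for \<rho>
      proof (cases "\<rho> \<subseteq> A")
        case True
        then show ?thesis using w1 neg that Csub by (metis subsetD)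
      next
        case False
        then have "w \<tau> * M_entry \<rho> \<tau> = 0" for \<tau>
          using w0[rule_format, of \<tau>] by (cases "\<rho> \<subseteq> \<tau>") (auto simp: M_entry_def)
        then have "(\<Sum>\<tau>\<in>binom n (p + 1). w \<tau> * M_entry \<rho> \<tau>) = 0"
          by (intro sum.neutral ballI)
        moreover have "\<rho> \<noteq> \<sigma>" using False \<sigma> by blast
        ultimately show ?thesis by simp
      qed
      \<comment> \<open>The pairing of \<open>w\<close> with the dependency \<open>a\<close> is
        evaluated in two ways: by columns it is zero, by rows it is
        \<open>a \<sigma>\<close>.\<close>
      have "0 = (\<Sum>\<tau>\<in>binom n (p + 1). w \<tau> * (\<Sum>\<rho>\<in>C. a \<rho> * M_entry \<rho> \<tau>))"
        using a(2) by (intro sum.neutral[symmetric]) simp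
      also have "\<dots> = (\<Sum>\<tau>\<in>binom n (p + 1). \<Sum>\<rho>\<in>C. a \<rho> * (w \<tau> * M_entry \<rho> \<tau>))"
        by (simp add: sum_distrib_left algebra_simps)
      also have "\<dots> = (\<Sum>\<rho>\<in>C. \<Sum>\<tau>\<in>binom n (p + 1). a \<rho> * (w \<tau> * M_entry \<rho> \<tau>))"
        by (rule sum.swap)
      also have "\<dots> = (\<Sum>\<rho>\<in>C. if \<rho> = \<sigma> then a \<rho> else 0)"
        unfolding sum_distrib_left[symmetric] using v by (intro sum.cong) auto
      also have "\<dots> = a \<sigma>" using fin \<sigma>C by simp
      finally show False using a(1) by simp
    qed
  qed
next
  assume R: ?R
  define G where "G = {\<rho>\<in>binom n p. \<rho> \<subseteq> A \<and> \<not> Q \<rho>}"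
  define T where "T = {\<tau>\<in>binom n (p + 1). \<tau> \<subseteq> A}"
  have fin: "finite T" "finite G" by (simp_all add: T_def G_def)
  from fredholm_alternative[OF fin, of "M_entry :: _ \<Rightarrow> _ \<Rightarrow> 'k" "\<lambda>\<rho>. if \<rho> = \<sigma> then 1 else 0"]
  show ?L
  proof (elim disjE exE conjE)
    fix w :: "nat set \<Rightarrow> 'k"
    assume w: "\<forall>r\<in>G. (\<Sum>t\<in>T. w t * M_entry r t) = (if r = \<sigma> then 1 else 0)"
    define w' where "w' \<tau> = (if \<tau> \<subseteq> A then w \<tau> else 0)" for \<tau>
    have "(\<Sum>\<tau>\<in>binom n (p + 1). w' \<tau> * M_entry \<rho> \<tau>) = (\<Sum>t\<in>T. w t * M_entry \<rho> t)" for \<rho>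
      by (rule sum.mono_neutral_cong_right) (auto simp: T_def w'_def)
    then show ?L using w by (intro exI[of _ w']) (auto simp: w'_def G_def)
  next
    fix l :: "nat set \<Rightarrow> 'k"
    assume l: "\<forall>t\<in>T. (\<Sum>r\<in>G. l r * M_entry r t) = 0"
      and l\<sigma>: "(\<Sum>r\<in>G. l r * (if r = \<sigma> then 1 else 0)) \<noteq> 0"
    define l' where "l' \<rho> = (if \<rho> \<in> G then l \<rho> else 0)" for \<rho>
    have "(\<Sum>r\<in>G. l r * (if r = \<sigma> then 1 else 0)) = (\<Sum>r\<in>G. if r = \<sigma> then l r else 0)"
      by (rule sum.cong) auto
    then have \<sigma>G: "\<sigma> \<in> G" "l \<sigma> \<noteq> 0" using l\<sigma> fin by (auto split: if_splits)
    \<comment> \<open>The certificate, extended by zero off \<open>G\<close>, is a cocycle only on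
      the simplex \<open>A\<close>, since nothing is known about the other columns.\<close>
    have cl: "cob l' \<tau> = 0" if "\<tau> \<subseteq> A" "card \<tau> = p + 1" for \<tau>
    proof -
      have \<tau>: "\<tau> \<in> binom n (p + 1)" using that A by (auto simp: binom_def)
      have "cob l' \<tau> = (\<Sum>\<rho>\<in>binom n p. l' \<rho> * M_entry \<rho> \<tau>)" by (rule sum_M_entry[OF \<tau>, symmetric])
      also have "\<dots> = (\<Sum>r\<in>G. l r * M_entry r \<tau>)"
        by (rule sum.mono_neutral_cong_right) (auto simp: G_def l'_def)
      also have "\<dots> = 0" using l \<tau> that by (simp add: T_def)
      finally show ?thesis .
    qed
    have ne: "\<tau> \<noteq> {}" if "card \<tau> = p" for \<tau> :: "nat set" using that p by auto
    have A': "finite A" "A \<noteq> {}"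
      using finite_subset[OF A] \<sigma> ne[of \<sigma>] by (auto simp: binom_def)
    obtain w where w: "\<And>\<tau>. \<tau> \<subseteq> A \<Longrightarrow> card \<tau> = p \<Longrightarrow> cob w \<tau> = l' \<tau>"
      using cocycle_is_coboundary[OF A' cl] ne by metis
    \<comment> \<open>Replacing \<open>l'\<close> by \<open>cob w\<close> turns the dependency on
      the columns inside \<open>A\<close> into one on all columns.\<close>
    have z0: "\<forall>\<tau>\<in>binom n (p + 1). (\<Sum>\<rho>\<in>binom n p. cob w \<rho> * M_entry \<rho> \<tau>) = 0"
      by (simp add: sum_M_entry[unfolded Suc_eq_plus1[symmetric]] cob_cob binom_finite)
    have "cob w \<sigma> \<noteq> 0" using w[of \<sigma>] \<sigma> \<sigma>G by (simp add: binom_def l'_def)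
    then obtain C where C: "C \<in> circuits TYPE('k) n p" "\<sigma> \<in> C" "\<And>\<rho>. \<rho> \<in> C \<Longrightarrow> cob w \<rho> \<noteq> 0"
      using circuit_exists[OF z0 \<sigma>(1)] by blast
    \<comment> \<open>Contradiction: inside \<open>A\<close> the circuit lives on the support of
      \<open>l'\<close>, hence in \<open>G\<close>, where \<open>Q\<close> fails.\<close>
    then obtain \<rho> where \<rho>: "\<rho> \<in> C" "\<rho> \<subseteq> A" "Q \<rho>" using R by blast
    have "\<rho> \<in> binom n p" using C \<rho> by (auto simp: circuits_def)
    then have "cob w \<rho> = 0" using w[of \<rho>] \<rho> by (auto simp: l'_def G_def binom_def)
    then show ?L using C \<rho> by blast
  qed
qed



section \<open>Monomial ideals\<close>

lemma poly_mapping_single_sum: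
  "f = (\<Sum>m\<in>Poly_Mapping.keys f. Poly_Mapping.single m (Poly_Mapping.lookup f m))"
proof (rule poly_mapping_eqI)
  fix t
  have "(\<Sum>m\<in>Poly_Mapping.keys f. Poly_Mapping.lookup (Poly_Mapping.single m (Poly_Mapping.lookup f m)) t)
      = (\<Sum>m\<in>Poly_Mapping.keys f. if m = t then Poly_Mapping.lookup f m else 0)"
    by (rule sum.cong) (auto simp: lookup_single when_def)
  then show "Poly_Mapping.lookup f t
      = Poly_Mapping.lookup (\<Sum>m\<in>Poly_Mapping.keys f. Poly_Mapping.single m (Poly_Mapping.lookup f m)) t"
    by (simp add: lookup_sum in_keys_iff)
qed

text \<open>Cancellation of exponents leaves a single pair in the convolution, so a monomial factor
  merely translates coefficients.\<close>

lemma lookup_single_mult: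
  fixes f :: "('a::cancel_comm_monoid_add) \<Rightarrow>\<^sub>0 'b::semiring_0"
  shows "Poly_Mapping.lookup (Poly_Mapping.single m c * f) (m + k) = c * Poly_Mapping.lookup f k"
proof -
  have "Poly_Mapping.lookup (Poly_Mapping.single m c * f) (m + k)
      = (\<Sum>l. (c * (\<Sum>q. Poly_Mapping.lookup f q when m + k = l + q)) when l = m)"
    unfolding lookup_mult by (rule Sum_any.cong) (auto simp: lookup_single when_def)
  then show ?thesis by simp
qed

lemma lookup_single_mult_eq_0:
  fixes f :: "('a::monoid_add) \<Rightarrow>\<^sub>0 'b::semiring_0"
  assumes "\<And>k. t \<noteq> m + k"
  shows "Poly_Mapping.lookup (Poly_Mapping.single m c * f) t = 0"
proof -
  have "t \<notin> Poly_Mapping.keys (Poly_Mapping.single m c * f)"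
    using keys_mult[of "Poly_Mapping.single m c" f] assms by (auto split: if_splits)
  then show ?thesis by (simp add: in_keys_iff)
qed

lemma keys_plus_nat:
  fixes m m' :: "'a \<Rightarrow>\<^sub>0 nat"
  shows "Poly_Mapping.keys (m + m') = Poly_Mapping.keys m \<union> Poly_Mapping.keys m'"
  by (auto simp: in_keys_iff lookup_add)

section \<open>The polynomial ring as a commutative ring\<close>

lemma poly_ring_simps [simp]:
  "mult (poly_ring n) = (*)" "one (poly_ring n) = 1" "zero (poly_ring n) = 0" "add (poly_ring n) = (+)"
  by (simp_all add: poly_ring_def)

lemma mem_carrier_poly_ring:
  "f \<in> carrier (poly_ring n) \<longleftrightarrow> (\<forall>m\<in>Poly_Mapping.keys f. Poly_Mapping.keys m \<subseteq> {1..n})"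
  by (simp add: poly_ring_def)

lemma poly_ring_zero_closed: "0 \<in> carrier (poly_ring n)"
  by (simp add: mem_carrier_poly_ring)

lemma poly_ring_one_closed: "1 \<in> carrier (poly_ring n)"
  by (simp add: mem_carrier_poly_ring)

lemma poly_ring_plus_closed:
  "f \<in> carrier (poly_ring n) \<Longrightarrow> g \<in> carrier (poly_ring n) \<Longrightarrow> f + g \<in> carrier (poly_ring n)"
  unfolding mem_carrier_poly_ring using keys_add[of f g] by blast

lemma poly_ring_uminus_closed: "f \<in> carrier (poly_ring n) \<Longrightarrow> - f \<in> carrier (poly_ring n)"
  by (simp add: mem_carrier_poly_ring in_keys_iff)

lemma poly_ring_times_closed:
  assumes "f \<in> carrier (poly_ring n)" "g \<in> carrier (poly_ring n)"
  shows "f * g \<in> carrier (poly_ring n)"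
  unfolding mem_carrier_poly_ring
proof
  fix m assume "m \<in> Poly_Mapping.keys (f * g)"
  then obtain a b where "m = a + b" "a \<in> Poly_Mapping.keys f" "b \<in> Poly_Mapping.keys g"
    using keys_mult[of f g] by blast
  then show "Poly_Mapping.keys m \<subseteq> {1..n}"
    using assms unfolding mem_carrier_poly_ring by (simp add: keys_plus_nat)
qed

lemma poly_ring_cring: "cring (poly_ring n :: 'k::field poly_nat ring)"
proof (rule cringI)
  show "abelian_group (poly_ring n :: 'k poly_nat ring)"
  proof (rule abelian_groupI)
    fix f :: "'k poly_nat" assume "f \<in> carrier (poly_ring n)"
    then show "\<exists>g\<in>carrier (poly_ring n). g \<oplus>\<^bsub>poly_ring n\<^esub> f = \<zero>\<^bsub>poly_ring n\<^esub>"
      by (intro bexI[of _ "- f"]) (auto intro: poly_ring_uminus_closed)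
  qed (simp_all add: poly_ring_plus_closed poly_ring_zero_closed add_ac)
  show "comm_monoid (poly_ring n :: 'k poly_nat ring)"
    by (rule comm_monoidI) (simp_all add: poly_ring_times_closed poly_ring_one_closed mult_ac)
qed (simp add: distrib_right)

lemma poly_ring_minus:
  assumes "f \<in> carrier (poly_ring n)"
  shows "\<ominus>\<^bsub>poly_ring n\<^esub> f = - f"
proof -
  interpret cring "poly_ring n :: 'a poly_nat ring" by (rule poly_ring_cring)
  show ?thesis using minus_equality[of "- f" f] assms poly_ring_uminus_closed[OF assms] by simp
qed

lemma poly_ring_finsum:
  assumes "\<And>i. i \<in> A \<Longrightarrow> f i \<in> carrier (poly_ring n)"
  shows "finsum (poly_ring n) f A = sum f A"
proof -
  interpret cring "poly_ring n :: 'b poly_nat ring" by (rule poly_ring_cring)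
  show ?thesis using assms
    by (induction A rule: infinite_finite_induct) (simp_all add: finsum_infinite Pi_def)
qed

lemma poly_ring_sum_closed:
  assumes "\<And>i. i \<in> A \<Longrightarrow> f i \<in> carrier (poly_ring n)"
  shows "sum f A \<in> carrier (poly_ring n)"
  using assms
  by (induction A rule: infinite_finite_induct)
    (simp_all add: poly_ring_plus_closed poly_ring_zero_closed)

lemma poly_ring_neg_one_pow_closed: "(- 1) ^ k \<in> carrier (poly_ring n)"
  by (induction k) (simp_all add: poly_ring_one_closed poly_ring_uminus_closed)

lemma poly_ring_neg_one_pow_times_closed:
  "f \<in> carrier (poly_ring n) \<Longrightarrow> (- 1) ^ k * f \<in> carrier (poly_ring n)"
  by (intro poly_ring_times_closed poly_ring_neg_one_pow_closed)

lemma Var_closed: "i \<in> {1..n} \<Longrightarrow> Var i \<in> carrier (poly_ring n)"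
  by (simp add: Var_def mem_carrier_poly_ring)

section \<open>Monomial ideals as upward closed sets of exponents\<close>

lemma exponent_ideal:
  fixes E :: "(nat \<Rightarrow>\<^sub>0 nat) set"
  assumes E: "\<And>m. m \<in> E \<Longrightarrow> Poly_Mapping.keys m \<subseteq> {1..n}"
    and up: "\<And>m k. m \<in> E \<Longrightarrow> Poly_Mapping.keys k \<subseteq> {1..n} \<Longrightarrow> m + k \<in> E"
  shows "ideal {f :: 'k::field poly_nat. Poly_Mapping.keys f \<subseteq> E} (poly_ring n)"
proof -
  let ?J = "{f :: 'k poly_nat. Poly_Mapping.keys f \<subseteq> E}"
  interpret S: cring "poly_ring n :: 'k poly_nat ring" by (rule poly_ring_cring)
  have J: "?J \<subseteq> carrier (poly_ring n)" using E by (force simp: mem_carrier_poly_ring)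
  have mult: "f * g \<in> ?J" if "f \<in> ?J" "g \<in> carrier (poly_ring n)" for f g
  proof -
    have "m \<in> E" if m: "m \<in> Poly_Mapping.keys (f * g)" for m
    proof -
      obtain a b where "m = a + b" "a \<in> Poly_Mapping.keys f" "b \<in> Poly_Mapping.keys g"
        using m keys_mult[of f g] by blast
      then show ?thesis using \<open>f \<in> ?J\<close> \<open>g \<in> _\<close> up by (auto simp: mem_carrier_poly_ring)
    qed
    then show ?thesis by blast
  qed
  show ?thesis
  proof (rule idealI[OF S.ring_axioms])
    show "subgroup ?J (add_monoid (poly_ring n))"
    proof
      show "?J \<subseteq> carrier (add_monoid (poly_ring n))" using J by simp
      show "f \<otimes>\<^bsub>add_monoid (poly_ring n)\<^esub> g \<in> ?J" if "f \<in> ?J" "g \<in> ?J" for f g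
        using that keys_add[of f g] by auto
      show "\<one>\<^bsub>add_monoid (poly_ring n)\<^esub> \<in> ?J" by simp
      show "inv\<^bsub>add_monoid (poly_ring n)\<^esub> f \<in> ?J" if f: "f \<in> ?J" for f
      proof -
        have "inv\<^bsub>add_monoid (poly_ring n)\<^esub> f = - f"
          using poly_ring_minus[of f n] f J by (auto simp: a_inv_def)
        then show ?thesis using f by (auto simp: in_keys_iff)
      qed
    qed
    fix f g :: "'k poly_nat" assume "f \<in> ?J" "g \<in> carrier (poly_ring n)"
    then show "g \<otimes>\<^bsub>poly_ring n\<^esub> f \<in> ?J" "f \<otimes>\<^bsub>poly_ring n\<^esub> g \<in> ?J"
      using mult[of f g] by (simp_all add: mult.commute)
  qed
qed

text \<open>Multiples of generating monomials already span the ideal, so membership in I can be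
  tested on each exponent of a polynomial separately. Everything later uses only the set
  \<open>E\<close>.\<close>

lemma monomial_ideal_exponents:
  assumes "monomial_ideal n (I :: 'k::field poly_nat set)"
  obtains E where "I = {f. Poly_Mapping.keys f \<subseteq> E}"
    "\<And>m. m \<in> E \<Longrightarrow> Poly_Mapping.keys m \<subseteq> {1..n}"
    "\<And>m k. m \<in> E \<Longrightarrow> Poly_Mapping.keys k \<subseteq> {1..n} \<Longrightarrow> m + k \<in> E"
proof -
  interpret S: cring "poly_ring n :: 'k poly_nat ring" by (rule poly_ring_cring)
  obtain M where M: "M \<subseteq> monomials n" and I: "I = genideal (poly_ring n) M"
    using assms by (auto simp: monomial_ideal_def)
  \<comment> \<open>The cofactor is confined to the variables 1 to n, because exponent vectors range
    over infinitely many variables.\<close>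
  define E where "E = {m + k |m k. Poly_Mapping.single m (1::'k) \<in> M \<and> Poly_Mapping.keys k \<subseteq> {1..n}}"
  have "Poly_Mapping.keys m \<subseteq> {1..n}" if m: "Poly_Mapping.single m (1::'k) \<in> M" for m
  proof -
    from m M obtain m' where m': "Poly_Mapping.single m (1::'k) = Poly_Mapping.single m' 1"
      "Poly_Mapping.keys m' \<subseteq> {1..n}" by (auto simp: monomials_def)
    have "Poly_Mapping.keys (Poly_Mapping.single m (1::'k)) = Poly_Mapping.keys (Poly_Mapping.single m' (1::'k))"
      by (simp only: m'(1))
    then show ?thesis using m'(2) by simp
  qed
  then have 1: "\<And>m. m \<in> E \<Longrightarrow> Poly_Mapping.keys m \<subseteq> {1..n}"
    unfolding E_def by (force simp: keys_plus_nat)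
  have 2: "m + k \<in> E" if mE: "m \<in> E" and k: "Poly_Mapping.keys k \<subseteq> {1..n}" for m k
  proof -
    obtain a b where ab: "m = a + b" "Poly_Mapping.single a (1::'k) \<in> M" "Poly_Mapping.keys b \<subseteq> {1..n}"
      using mE unfolding E_def by blast
    then have "m + k = a + (b + k)" "Poly_Mapping.keys (b + k) \<subseteq> {1..n}"
      using k by (simp_all add: keys_plus_nat add.assoc)
    then show ?thesis unfolding E_def using ab by blast
  qed
  let ?J = "{f :: 'k poly_nat. Poly_Mapping.keys f \<subseteq> E}"
  have J: "ideal ?J (poly_ring n)" using 1 2 by (rule exponent_ideal)
  have "M \<subseteq> carrier (poly_ring n)"
    using M by (auto simp: monomials_def mem_carrier_poly_ring)
  then have idI: "ideal I (poly_ring n)" and MI: "M \<subseteq> I"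
    unfolding I by (auto intro: S.genideal_ideal S.genideal_self[THEN subsetD])
  interpret I: ideal I "poly_ring n" by (rule idI)
  have "M \<subseteq> ?J"
  proof
    fix f assume f: "f \<in> M"
    then obtain m where "f = Poly_Mapping.single m 1" using M by (auto simp: monomials_def)
    then show "f \<in> ?J" using f unfolding E_def by (force intro: exI[of _ 0])
  qed
  then have "I \<subseteq> ?J" unfolding I by (rule S.genideal_minimal[OF J])
  moreover have "f \<in> I" if f: "f \<in> ?J" for f
  proof -
    \<comment> \<open>The scalar is put on the cofactor, as the generators have coefficient
      one.\<close>
    have mon: "Poly_Mapping.single m c \<in> I" if mE: "m \<in> E" for m and c :: 'k
    proof -
      obtain a b where ab: "m = a + b" "Poly_Mapping.single a (1::'k) \<in> M" "Poly_Mapping.keys b \<subseteq> {1..n}"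
        using mE unfolding E_def by blast
      have "Poly_Mapping.single b c \<in> carrier (poly_ring n)" using ab by (simp add: mem_carrier_poly_ring)
      then have "Poly_Mapping.single a 1 * Poly_Mapping.single b c \<in> I"
        using I.I_r_closed[of "Poly_Mapping.single a 1" "Poly_Mapping.single b c"] ab MI by auto
      then show ?thesis by (simp add: mult_single ab)
    qed
    have "sum g X \<in> I" if "\<And>x. x \<in> X \<Longrightarrow> g x \<in> I" for g and X :: "(nat \<Rightarrow>\<^sub>0 nat) set"
      using that
      by (induction X rule: infinite_finite_induct) (use I.a_closed I.zero_closed in auto)
    then have "(\<Sum>m\<in>Poly_Mapping.keys f. Poly_Mapping.single m (Poly_Mapping.lookup f m)) \<in> I"
      using mon f by (simp add: subset_iff)
    then show ?thesis by (subst poly_mapping_single_sum)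
  qed
  ultimately have "I = ?J" by blast
  then show thesis using 1 2 that by blast
qed

text \<open>The exponent of the squarefree monomial x_A, which is also the multidegree of the basis
  element e_A.\<close>

definition expo :: "nat set \<Rightarrow> nat \<Rightarrow>\<^sub>0 nat" where
  "expo A = (\<Sum>a\<in>A. Poly_Mapping.single a 1)"

lemma lookup_expo: "finite A \<Longrightarrow> Poly_Mapping.lookup (expo A) i = (if i \<in> A then 1 else 0)"
  by (simp add: expo_def lookup_sum lookup_single when_def)

lemma keys_expo: "finite A \<Longrightarrow> Poly_Mapping.keys (expo A) = A"
  by (auto simp: in_keys_iff lookup_expo split: if_splits)

lemma Var_prod_eq: "finite A \<Longrightarrow> Var_prod A = Poly_Mapping.single (expo A) 1"
  unfolding Var_prod_def expo_def
  by (induction A rule: finite_induct) (simp_all add: Var_def mult_single)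

text \<open>Both sides are the exponent of the squarefree monomial of \<sigma> \<union>
  \<rho>.\<close>

lemma expo_Diff_add:
  assumes "finite \<sigma>" "finite \<rho>"
  shows "expo \<sigma> + expo (\<rho> - \<sigma>) = expo \<rho> + expo (\<sigma> - \<rho>)"
  using assms by (intro poly_mapping_eqI) (simp add: lookup_add lookup_expo)

lemma expo_remove:
  "finite \<tau> \<Longrightarrow> s \<in> \<tau> \<Longrightarrow> expo \<tau> = expo (\<tau> - {s}) + Poly_Mapping.single s 1"
  by (simp add: expo_def sum.remove add.commute)

text \<open>Subtraction of exponents is truncated; it is a genuine division here because \<rho> lies
  in the support of \<open>a\<close>.\<close>

lemma expo_dvd:
  fixes a :: "nat \<Rightarrow>\<^sub>0 nat"
  assumes "finite \<rho>" "\<rho> \<subseteq> Poly_Mapping.keys a"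
  shows "a = expo \<rho> + (a - expo \<rho>)"
proof (rule poly_mapping_eqI)
  fix i
  have "i \<in> \<rho> \<Longrightarrow> Poly_Mapping.lookup a i \<noteq> 0" using assms by (auto simp: in_keys_iff)
  then show "Poly_Mapping.lookup a i = Poly_Mapping.lookup (expo \<rho> + (a - expo \<rho>)) i"
    using assms by (auto simp: lookup_add lookup_minus lookup_expo)
qed

text \<open>A monomial lies in a sum of monomial ideals iff it lies in one summand. In the summand
  of \<rho>, dividing by the monomial of \<rho> - \<sigma> and multiplying by that of \<sigma> -
  \<rho> amounts to passing from m to m + e_sigma - e_rho.\<close>

lemma monomial_mem_ideal_sum_iff:
  assumes I: "I = {f. Poly_Mapping.keys f \<subseteq> E}"
    and \<sigma>: "finite \<sigma>" and C: "finite C" "\<And>\<rho>. \<rho> \<in> C \<Longrightarrow> finite \<rho>"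
    and m: "Poly_Mapping.keys m \<subseteq> {1..n}"
  shows "Poly_Mapping.single m (1::'k::field) \<in> ideal_sum C (shifted_colon n I \<sigma>)
    \<longleftrightarrow> (\<exists>\<rho>\<in>C. \<exists>e\<in>E. m + expo \<sigma> = expo \<rho> + e)"
proof
  assume "Poly_Mapping.single m (1::'k) \<in> ideal_sum C (shifted_colon n I \<sigma>)"
  then obtain f where f: "Poly_Mapping.single m (1::'k) = (\<Sum>\<rho>\<in>C. f \<rho>)"
    "\<And>\<rho>. \<rho> \<in> C \<Longrightarrow> f \<rho> \<in> shifted_colon n I \<sigma> \<rho>" by (auto simp: ideal_sum_def)
  \<comment> \<open>The coefficient at \<open>m\<close> must come from some summand, which selects
    \<rho>.\<close>
  have "(\<Sum>\<rho>\<in>C. Poly_Mapping.lookup (f \<rho>) m) = 1"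
    unfolding lookup_sum[symmetric] f(1)[symmetric] by simp
  then obtain \<rho> where \<rho>: "\<rho> \<in> C" "Poly_Mapping.lookup (f \<rho>) m \<noteq> 0"
    by (metis (mono_tags, lifting) sum.neutral zero_neq_one)
  then have fin: "finite \<rho>" using C by blast
  obtain g where g: "f \<rho> = Var_prod (\<rho> - \<sigma>) * g" "g * Var_prod (\<sigma> - \<rho>) \<in> I"
    using f(2)[OF \<rho>(1)] by (auto simp: shifted_colon_def colon_def)
  have lk: "Poly_Mapping.lookup (Poly_Mapping.single (expo (\<rho> - \<sigma>)) 1 * g) m \<noteq> 0"
    using \<rho>(2) fin by (simp add: g Var_prod_eq)
  then obtain k where k: "m = expo (\<rho> - \<sigma>) + k"
    using lookup_single_mult_eq_0[of m "expo (\<rho> - \<sigma>)"] by blast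
  then have "Poly_Mapping.lookup g k \<noteq> 0" using lk by (simp add: lookup_single_mult)
  then have "Poly_Mapping.lookup (Poly_Mapping.single (expo (\<sigma> - \<rho>)) 1 * g) (expo (\<sigma> - \<rho>) + k) \<noteq> 0"
    by (simp add: lookup_single_mult)
  then have "expo (\<sigma> - \<rho>) + k \<in> E"
    using g(2) \<sigma> by (auto simp: I Var_prod_eq mult.commute in_keys_iff)
  moreover have "m + expo \<sigma> = expo \<rho> + (expo (\<sigma> - \<rho>) + k)"
    using expo_Diff_add[OF \<sigma> fin] by (simp add: k add_ac)
  ultimately show "\<exists>\<rho>\<in>C. \<exists>e\<in>E. m + expo \<sigma> = expo \<rho> + e" using \<rho> by blast
next
  assume "\<exists>\<rho>\<in>C. \<exists>e\<in>E. m + expo \<sigma> = expo \<rho> + e"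
  then obtain \<rho> e where \<rho>: "\<rho> \<in> C" and e: "e \<in> E" "m + expo \<sigma> = expo \<rho> + e" by blast
  have fin: "finite \<rho>" using C \<rho> by blast
  have "m + expo \<sigma> + expo (\<rho> - \<sigma>) = expo \<rho> + e + expo (\<rho> - \<sigma>)" using e by simp
  then have "expo \<rho> + (m + expo (\<sigma> - \<rho>)) = expo \<rho> + (expo (\<rho> - \<sigma>) + e)"
    using expo_Diff_add[OF \<sigma> fin] by (simp add: add_ac)
  then have me: "m + expo (\<sigma> - \<rho>) = expo (\<rho> - \<sigma>) + e" by simp
  \<comment> \<open>As \<rho> - \<sigma> and \<sigma> - \<rho> are disjoint, the squarefree factor
    of \<rho> - \<sigma> has to divide x^m itself.\<close>
  have "\<rho> - \<sigma> \<subseteq> Poly_Mapping.keys (m + expo (\<sigma> - \<rho>))"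
    unfolding me using fin by (simp add: keys_plus_nat keys_expo)
  then have "\<rho> - \<sigma> \<subseteq> Poly_Mapping.keys m" using \<sigma> by (auto simp: keys_plus_nat keys_expo)
  then obtain k where k: "m = expo (\<rho> - \<sigma>) + k" using expo_dvd[of "\<rho> - \<sigma>" m] fin by blast
  then have ke: "k + expo (\<sigma> - \<rho>) = e" using me by (simp add: add.assoc)
  define g where "g = Poly_Mapping.single k (1::'k)"
  have "g \<in> colon n I (Var_prod (\<sigma> - \<rho>))"
    using \<sigma> e(1) m by (auto simp: g_def colon_def mem_carrier_poly_ring k keys_plus_nat Var_prod_eq mult_single ke I)
  then have mem: "Poly_Mapping.single m 1 \<in> shifted_colon n I \<sigma> \<rho>"
    unfolding shifted_colon_def using fin
    by (intro image_eqI[of _ _ g]) (simp_all add: g_def Var_prod_eq mult_single k)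
  have zero: "0 \<in> shifted_colon n I \<sigma> \<rho>'" for \<rho>'
    unfolding shifted_colon_def
    by (intro image_eqI[of _ _ 0]) (simp_all add: colon_def I mem_carrier_poly_ring)
  show "Poly_Mapping.single m (1::'k) \<in> ideal_sum C (shifted_colon n I \<sigma>)"
    unfolding ideal_sum_def using C \<rho> mem zero
    by (intro CollectI exI[of _ "\<lambda>\<rho>'. if \<rho>' = \<rho> then Poly_Mapping.single m 1 else 0"]) auto
qed



section \<open>Boundaries in the Koszul complex\<close>

context cring
begin

lemma neg_one_pow_closed: "neg_one_pow R k \<in> carrier R"
  by (simp add: neg_one_pow_def)

lemma ebasis_closed: "ebasis R \<sigma> \<rho> \<in> carrier R"
  by (simp add: ebasis_def)

lemma wedge_basis_closed: "wedge_basis R \<sigma> \<tau> \<rho> \<in> carrier R"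
  by (simp add: wedge_basis_def scale_def neg_one_pow_closed ebasis_closed)

text \<open>Only the pair of index sets ({j}, \<sigma>) survives in the double sum. The scalar
  \<open>a\<close> is there to carry the sign accumulated from the factors further right.\<close>

lemma wedge_ebasis:
  assumes j: "j \<in> {1..n}" "j \<notin> \<sigma>" and \<sigma>: "\<sigma> \<subseteq> {1..n}" and a: "a \<in> carrier R"
  shows "wedge R n (ebasis R {j}) (scale R a (ebasis R \<sigma>))
    = scale R (a \<otimes> neg_one_pow R (card {(s, t). s \<in> {j} \<and> t \<in> \<sigma> \<and> t < s})) (ebasis R (insert j \<sigma>))"
    (is "_ = scale R (a \<otimes> ?e) _")
proof
  fix \<rho>
  have inner: "(\<Oplus>\<tau>\<in>Pow {1..n}. (ebasis R {j} s \<otimes> scale R a (ebasis R \<sigma>) \<tau>) \<otimes> wedge_basis R s \<tau> \<rho>)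
      = (if s = {j} then a \<otimes> wedge_basis R {j} \<sigma> \<rho> else \<zero>)" for s
  proof -
    have "(\<Oplus>\<tau>\<in>Pow {1..n}. (ebasis R {j} s \<otimes> scale R a (ebasis R \<sigma>) \<tau>) \<otimes> wedge_basis R s \<tau> \<rho>)
      = (\<Oplus>\<tau>\<in>Pow {1..n}. if \<tau> = \<sigma> then (if s = {j} then a \<otimes> wedge_basis R {j} \<tau> \<rho> else \<zero>) else \<zero>)"
      using a by (intro finsum_cong') (auto simp: ebasis_def scale_def wedge_basis_closed)
    also have "\<dots> = (if s = {j} then a \<otimes> wedge_basis R {j} \<sigma> \<rho> else \<zero>)"
      using \<sigma> a by (subst add.finprod_singleton_swap) (auto simp: wedge_basis_closed)
    finally show ?thesis .
  qed
  have "wedge R n (ebasis R {j}) (scale R a (ebasis R \<sigma>)) \<rho>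
      = (\<Oplus>s\<in>Pow {1..n}. if s = {j} then a \<otimes> wedge_basis R {j} \<sigma> \<rho> else \<zero>)"
    unfolding wedge_def inner ..
  also have "\<dots> = a \<otimes> wedge_basis R {j} \<sigma> \<rho>"
    using j a by (subst add.finprod_singleton_swap) (auto simp: wedge_basis_closed)
  also have "\<dots> = scale R (a \<otimes> ?e) (ebasis R (insert j \<sigma>)) \<rho>"
    using j a by (simp add: wedge_basis_def scale_def m_assoc neg_one_pow_closed ebasis_closed)
  finally show "wedge R n (ebasis R {j}) (scale R a (ebasis R \<sigma>)) \<rho>
      = scale R (a \<otimes> ?e) (ebasis R (insert j \<sigma>)) \<rho>" .
qed

text \<open>Sorting the indices costs a sign. Its value is left open, because a unit factor does not
  affect being a boundary.\<close>

lemma wedge_list_eq: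
  assumes "distinct js" "set js \<subseteq> {1..n}"
  obtains k where "wedge_list R n js = scale R (neg_one_pow R k) (ebasis R (set js))"
proof -
  have "\<exists>k. wedge_list R n js = scale R (neg_one_pow R k) (ebasis R (set js))"
    using assms
  proof (induction js)
    case Nil
    show ?case
      by (intro exI[of _ 0]) (simp add: wedge_list_def scale_def neg_one_pow_def ebasis_closed)
  next
    case (Cons j js)
    then obtain k where "wedge_list R n js = scale R (neg_one_pow R k) (ebasis R (set js))"
      by auto
    then have "wedge_list R n (j # js)
        = wedge R n (ebasis R {j}) (scale R (neg_one_pow R k) (ebasis R (set js)))"
      by (simp add: wedge_list_def)
    then obtain l where "wedge_list R n (j # js)
        = scale R (neg_one_pow R k \<otimes> neg_one_pow R l) (ebasis R (set (j # js)))"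
      using wedge_ebasis[of j n "set js" "neg_one_pow R k"] Cons.prems neg_one_pow_closed by auto
    also have "neg_one_pow R k \<otimes> neg_one_pow R l = neg_one_pow R (k + l)"
      by (simp add: neg_one_pow_def nat_pow_mult)
    finally show ?case by blast
  qed
  then show thesis using that by blast
qed

end

section \<open>The Koszul differential on coordinates in \<open>S\<close>, and its image in
  \<open>R\<close>\<close>

definition koszul_sum :: "nat \<Rightarrow> nat \<Rightarrow> (nat set \<Rightarrow> 'k::field poly_nat) \<Rightarrow> nat set \<Rightarrow> 'k poly_nat" where
  "koszul_sum n q f \<rho> =
     (\<Sum>\<tau>\<in>binom n q. \<Sum>s\<in>\<tau>. if \<tau> - {s} = \<rho> then (- 1) ^ sgn_exp \<tau> s * (Var s * f \<tau>) else 0)"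

lemma koszul_sum_scale: "koszul_sum n q (\<lambda>\<tau>. e * f \<tau>) \<rho> = e * koszul_sum n q f \<rho>"
  unfolding koszul_sum_def sum_distrib_left by (intro sum.cong) (auto simp: algebra_simps)

lemma koszul_sum_term_closed:
  assumes "f \<tau> \<in> carrier (poly_ring n)" "\<tau> \<in> binom n q" "s \<in> \<tau>"
  shows "(if \<tau> - {s} = \<rho> then (- 1) ^ sgn_exp \<tau> s * (Var s * f \<tau>) else 0) \<in> carrier (poly_ring n)"
proof -
  have "s \<in> {1..n}" using assms by (auto simp: binom_def)
  then have "(- 1) ^ sgn_exp \<tau> s * (Var s * f \<tau>) \<in> carrier (poly_ring n)"
    using assms(1) by (intro poly_ring_neg_one_pow_times_closed poly_ring_times_closed Var_closed)
  then show ?thesis by (simp add: poly_ring_zero_closed)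
qed

lemma koszul_sum_closed:
  assumes "\<And>\<tau>. \<tau> \<in> binom n q \<Longrightarrow> f \<tau> \<in> carrier (poly_ring n)"
  shows "koszul_sum n q f \<rho> \<in> carrier (poly_ring n)"
  unfolding koszul_sum_def using assms by (intro poly_ring_sum_closed koszul_sum_term_closed)

locale poly_ring_ideal =
  fixes n :: nat and I :: "'k::field poly_nat set"
  assumes ideal_I: "ideal I (poly_ring n)"
begin

abbreviation "S \<equiv> poly_ring n :: 'k poly_nat ring"
abbreviation "R \<equiv> S Quot I"
abbreviation "bar \<equiv> residue n I"

sublocale S: cring S by (rule poly_ring_cring)
sublocale I: ideal I S by (rule ideal_I)
sublocale R: cring R by (rule I.quotient_is_cring[OF S.cring_axioms])
sublocale bar: ring_hom_cring S R bar
  unfolding residue_def using I.rcos_ring_hom_cring[OF S.cring_axioms] by (simp add: eta_contract_eq)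

lemma bar_sum:
  assumes "\<And>i. i \<in> A \<Longrightarrow> f i \<in> carrier S"
  shows "finsum R (\<lambda>i. bar (f i)) A = bar (sum f A)"
  using bar.hom_finsum[of f A] assms by (simp add: poly_ring_finsum Pi_def comp_def)

lemma bar_eq_iff:
  assumes "f \<in> carrier S" "g \<in> carrier S"
  shows "bar f = bar g \<longleftrightarrow> f - g \<in> I"
proof -
  have "f \<ominus>\<^bsub>S\<^esub> g = f - g" using assms by (simp add: a_minus_def poly_ring_minus)
  then show ?thesis
    using S.quotient_eq_iff_same_a_r_cos[OF ideal_I assms] by (auto simp: residue_def)
qed

lemma neg_one_pow_R: "neg_one_pow R k = bar ((- 1) ^ k)"
proof (induction k)
  case 0
  show ?case using bar.hom_one by (simp add: neg_one_pow_def)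
next
  case (Suc k)
  have "neg_one_pow R (Suc k) = neg_one_pow R k \<otimes>\<^bsub>R\<^esub> (\<ominus>\<^bsub>R\<^esub> \<one>\<^bsub>R\<^esub>)"
    by (simp add: neg_one_pow_def)
  also have "\<ominus>\<^bsub>R\<^esub> \<one>\<^bsub>R\<^esub> = bar (- 1)"
    using bar.hom_a_inv[of 1] bar.hom_one poly_ring_minus[of "1 :: 'k poly_nat" n]
    by (simp add: poly_ring_one_closed)
  also have "neg_one_pow R k \<otimes>\<^bsub>R\<^esub> bar (- 1) = bar ((- 1) ^ k * (- 1))"
    unfolding Suc using bar.hom_mult[of "(- 1) ^ k" "- 1"]
    by (simp add: poly_ring_neg_one_pow_closed poly_ring_uminus_closed poly_ring_one_closed)
  finally show ?case by simp
qed

text \<open>Reduction modulo I is a ring homomorphism, so it commutes with every term of the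
  differential and the computation can take place in \<open>S\<close> on chosen
  representatives.\<close>

lemma koszul_diff_bar:
  assumes f: "\<And>\<tau>. \<tau> \<in> binom n q \<Longrightarrow> f \<tau> \<in> carrier S"
    and c: "\<And>\<tau>. \<tau> \<in> binom n q \<Longrightarrow> c \<tau> = bar (f \<tau>)"
  shows "koszul_diff R (\<lambda>i. bar (Var i)) n q c \<rho> = bar (koszul_sum n q f \<rho>)"
proof -
  let ?t = "\<lambda>\<tau> s. if \<tau> - {s} = \<rho> then (- 1) ^ sgn_exp \<tau> s * (Var s * f \<tau>) else 0"
  have t: "(neg_one_pow R (sgn_exp \<tau> s) \<otimes>\<^bsub>R\<^esub> (bar (Var s) \<otimes>\<^bsub>R\<^esub> c \<tau>)) \<otimes>\<^bsub>R\<^esub> ebasis R (\<tau> - {s}) \<rho>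
      = bar (?t \<tau> s)" if \<tau>: "\<tau> \<in> binom n q" and s: "s \<in> \<tau>" for \<tau> s
  proof -
    have "s \<in> {1..n}" using \<tau> s by (auto simp: binom_def)
    then have V: "Var s \<in> carrier S" by (rule Var_closed)
    have "neg_one_pow R (sgn_exp \<tau> s) \<otimes>\<^bsub>R\<^esub> (bar (Var s) \<otimes>\<^bsub>R\<^esub> c \<tau>)
        = bar ((- 1) ^ sgn_exp \<tau> s * (Var s * f \<tau>))"
      using bar.hom_mult[OF V f[OF \<tau>]]
        bar.hom_mult[of "(- 1) ^ sgn_exp \<tau> s" "Var s * f \<tau>"]
      by (simp add: neg_one_pow_R c[OF \<tau>] poly_ring_neg_one_pow_closed
          poly_ring_times_closed[OF V f[OF \<tau>]])
    moreover have "(- 1) ^ sgn_exp \<tau> s * (Var s * f \<tau>) \<in> carrier S"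
      using V f[OF \<tau>] by (intro poly_ring_neg_one_pow_times_closed poly_ring_times_closed)
    ultimately show ?thesis
      using bar.hom_zero bar.hom_closed[of "(- 1) ^ sgn_exp \<tau> s * (Var s * f \<tau>)"]
      by (auto simp: ebasis_def)
  qed
  have tc: "?t \<tau> s \<in> carrier S" if "\<tau> \<in> binom n q" "s \<in> \<tau>" for \<tau> s
    by (rule koszul_sum_term_closed[of f, OF f[OF that(1)] that])
  have inner: "(\<Oplus>\<^bsub>R\<^esub>s\<in>\<tau>. (neg_one_pow R (sgn_exp \<tau> s) \<otimes>\<^bsub>R\<^esub> (bar (Var s) \<otimes>\<^bsub>R\<^esub> c \<tau>)) \<otimes>\<^bsub>R\<^esub> ebasis R (\<tau> - {s}) \<rho>)
      = bar (\<Sum>s\<in>\<tau>. ?t \<tau> s)" if \<tau>: "\<tau> \<in> binom n q" for \<tau>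
  proof -
    have "(\<Oplus>\<^bsub>R\<^esub>s\<in>\<tau>. (neg_one_pow R (sgn_exp \<tau> s) \<otimes>\<^bsub>R\<^esub> (bar (Var s) \<otimes>\<^bsub>R\<^esub> c \<tau>)) \<otimes>\<^bsub>R\<^esub> ebasis R (\<tau> - {s}) \<rho>)
        = (\<Oplus>\<^bsub>R\<^esub>s\<in>\<tau>. bar (?t \<tau> s))"
    proof (rule R.finsum_cong'[OF refl])
      show "(\<lambda>s. bar (?t \<tau> s)) \<in> \<tau> \<rightarrow> carrier R" using tc[OF \<tau>] by (intro Pi_I bar.hom_closed)
    qed (rule t[OF \<tau>])
    also have "\<dots> = bar (\<Sum>s\<in>\<tau>. ?t \<tau> s)" by (rule bar_sum[OF tc[OF \<tau>]])
    finally show ?thesis .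
  qed
  have sc: "(\<Sum>s\<in>\<tau>. ?t \<tau> s) \<in> carrier S" if "\<tau> \<in> binom n q" for \<tau>
    by (intro poly_ring_sum_closed tc that)
  have "koszul_diff R (\<lambda>i. bar (Var i)) n q c \<rho> = (\<Oplus>\<^bsub>R\<^esub>\<tau>\<in>binom n q. bar (\<Sum>s\<in>\<tau>. ?t \<tau> s))"
    unfolding koszul_diff_def
  proof (rule R.finsum_cong'[OF refl])
    show "(\<lambda>\<tau>. bar (\<Sum>s\<in>\<tau>. ?t \<tau> s)) \<in> binom n q \<rightarrow> carrier R"
      using sc by (intro Pi_I bar.hom_closed)
  qed (rule inner)
  also have "\<dots> = bar (koszul_sum n q f \<rho>)"
    unfolding koszul_sum_def by (rule bar_sum[OF sc])
  finally show ?thesis .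
qed

lemma koszul_chains_lift:
  assumes "c \<in> koszul_chains R n q"
  obtains f where "\<And>\<tau>. \<tau> \<in> binom n q \<Longrightarrow> f \<tau> \<in> carrier S" "\<And>\<tau>. \<tau> \<in> binom n q \<Longrightarrow> c \<tau> = bar (f \<tau>)"
proof -
  have "\<exists>g. g \<in> carrier S \<and> c \<tau> = bar g" if "\<tau> \<in> binom n q" for \<tau>
  proof -
    have "c \<tau> \<in> carrier R" using assms that by (simp add: koszul_chains_def)
    then show ?thesis
      by (auto simp: FactRing_def A_RCOSETS_def' a_r_coset_def' residue_def)
  qed
  then show thesis using that by metis
qed

text \<open>The sign of the sorted wedge is its own inverse and can be moved into the bounding
  chain. An equation in \<open>R\<close> thus becomes a family of congruences modulo I for an
  unsigned target.\<close>

lemma scale_wedge_boundary_iff: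
  assumes js: "distinct js" "set js \<subseteq> {1..n}" and u: "u \<in> carrier S"
  shows "scale R (bar u) (wedge_list R n js) \<in> koszul_boundaries R (\<lambda>i. bar (Var i)) n p \<longleftrightarrow>
    (\<exists>f. (\<forall>\<tau>\<in>binom n (Suc p). f \<tau> \<in> carrier S) \<and>
      (\<forall>\<rho>. koszul_sum n (Suc p) f \<rho> - (if \<rho> = set js then u else 0) \<in> I))"
    (is "?L \<longleftrightarrow> ?R")
proof -
  obtain k where k: "wedge_list R n js = scale R (neg_one_pow R k) (ebasis R (set js))"
    using R.wedge_list_eq[OF js] by blast
  define e :: "'k poly_nat" where "e = (- 1) ^ k"
  have e: "e \<in> carrier S" unfolding e_def by (rule poly_ring_neg_one_pow_closed)
  have ee: "e * e = 1" by (simp add: e_def flip: power_mult_distrib)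
  define v where "v \<rho> = (if \<rho> = set js then u else 0)" for \<rho>
  have v: "v \<rho> \<in> carrier S" for \<rho> using u by (simp add: v_def poly_ring_zero_closed)
  have ev: "e * v \<rho> \<in> carrier S" for \<rho> by (intro poly_ring_times_closed e v)
  have target: "scale R (bar u) (wedge_list R n js) \<rho> = bar (e * v \<rho>)" for \<rho>
  proof -
    have "neg_one_pow R k \<otimes>\<^bsub>R\<^esub> ebasis R (set js) \<rho> = bar (if \<rho> = set js then e else 0)"
      using bar.hom_zero bar.hom_closed[OF e] by (auto simp: neg_one_pow_R ebasis_def e_def)
    then have "scale R (bar u) (wedge_list R n js) \<rho> = bar u \<otimes>\<^bsub>R\<^esub> bar (if \<rho> = set js then e else 0)"
      by (simp add: k scale_def)
    also have "\<dots> = bar (u * (if \<rho> = set js then e else 0))"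
      using bar.hom_mult[OF u, of "if \<rho> = set js then e else 0"] e by (simp add: poly_ring_zero_closed)
    finally show ?thesis by (simp add: v_def mult.commute split: if_splits)
  qed
  show ?thesis
  proof
    assume ?L
    then obtain c where c: "c \<in> koszul_chains R n (Suc p)"
      "scale R (bar u) (wedge_list R n js) = koszul_diff R (\<lambda>i. bar (Var i)) n (Suc p) c"
      by (auto simp: koszul_boundaries_def)
    obtain f where f: "\<And>\<tau>. \<tau> \<in> binom n (Suc p) \<Longrightarrow> f \<tau> \<in> carrier S"
      "\<And>\<tau>. \<tau> \<in> binom n (Suc p) \<Longrightarrow> c \<tau> = bar (f \<tau>)"
      using koszul_chains_lift[OF c(1)] by blast
    have "koszul_sum n (Suc p) (\<lambda>\<tau>. e * f \<tau>) \<rho> - v \<rho> \<in> I" for \<rho>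
    proof -
      have "bar (koszul_sum n (Suc p) f \<rho>) = bar (e * v \<rho>)"
        using koszul_diff_bar[of "Suc p" f c \<rho>, OF f] target[of \<rho>] by (simp add: c(2))
      then have "koszul_sum n (Suc p) f \<rho> - e * v \<rho> \<in> I"
        by (subst bar_eq_iff[symmetric]) (auto intro: koszul_sum_closed f ev)
      \<comment> \<open>Multiplying by \<open>e\<close> cancels the sign on the target, since
        \<open>e * e = 1\<close>.\<close>
      then have "e * (koszul_sum n (Suc p) f \<rho> - e * v \<rho>) \<in> I" using I.I_l_closed e by simp
      moreover have "e * (e * v \<rho>) = v \<rho>" by (simp add: ee flip: mult.assoc)
      ultimately show ?thesis by (simp add: koszul_sum_scale right_diff_distrib)
    qed
    then show ?R using f e unfolding v_def
      by (intro exI[of _ "\<lambda>\<tau>. e * f \<tau>"]) (auto intro: poly_ring_times_closed)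
  next
    assume ?R
    then obtain f where f: "\<And>\<tau>. \<tau> \<in> binom n (Suc p) \<Longrightarrow> f \<tau> \<in> carrier S"
      and fI: "\<And>\<rho>. koszul_sum n (Suc p) f \<rho> - v \<rho> \<in> I" unfolding v_def by blast
    define c where "c \<tau> = (if \<tau> \<in> binom n (Suc p) then bar (e * f \<tau>) else \<zero>\<^bsub>R\<^esub>)" for \<tau>
    have ef: "e * f \<tau> \<in> carrier S" if "\<tau> \<in> binom n (Suc p)" for \<tau>
      by (intro poly_ring_times_closed e f that)
    have "c \<in> koszul_chains R n (Suc p)"
      using bar.hom_closed ef by (simp add: koszul_chains_def c_def)
    moreover have "scale R (bar u) (wedge_list R n js) \<rho> = koszul_diff R (\<lambda>i. bar (Var i)) n (Suc p) c \<rho>" for \<rho>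
    proof -
      have "koszul_diff R (\<lambda>i. bar (Var i)) n (Suc p) c \<rho> = bar (koszul_sum n (Suc p) (\<lambda>\<tau>. e * f \<tau>) \<rho>)"
        by (rule koszul_diff_bar) (simp_all add: ef c_def)
      also have "\<dots> = bar (e * v \<rho>)"
      proof (subst bar_eq_iff)
        have "e * (koszul_sum n (Suc p) f \<rho> - v \<rho>) \<in> I" using I.I_l_closed[OF fI e] by simp
        then show "koszul_sum n (Suc p) (\<lambda>\<tau>. e * f \<tau>) \<rho> - e * v \<rho> \<in> I"
          by (simp add: koszul_sum_scale right_diff_distrib)
      qed (auto intro: koszul_sum_closed ef ev)
      finally show ?thesis by (simp add: target)
    qed
    ultimately show ?L unfolding koszul_boundaries_def by blast
  qed
qed

end

section \<open>Comparison of coefficients in one multidegree\<close>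

lemma lookup_neg_one_pow_times:
  fixes f :: "'k::field poly_nat"
  shows "Poly_Mapping.lookup ((- 1) ^ k * f) t = (- 1) ^ k * Poly_Mapping.lookup f t"
  by (induction k) (simp_all add: mult.assoc)

lemma neg_one_pow_times_single:
  "(- 1) ^ k * Poly_Mapping.single m (c :: 'k::field) = Poly_Mapping.single m ((- 1) ^ k * c)"
  by (induction k) (simp_all add: mult.assoc single_uminus)

lemma single_sum: "Poly_Mapping.single t (sum g X) = (\<Sum>x\<in>X. Poly_Mapping.single t (g x))"
  by (induction X rule: infinite_finite_induct) (simp_all add: single_add)

text \<open>A p-subset of \<tau> misses exactly one vertex, so at most one summand is nonzero. In
  this form the entry can be matched with the terms of \<open>koszul_sum\<close>.\<close>

lemma M_entry_eq_sum:
  assumes \<rho>: "\<rho> \<in> binom n p" and \<tau>: "\<tau> \<in> binom n (p + 1)"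
  shows "M_entry \<rho> \<tau> = (\<Sum>s\<in>\<tau>. if \<tau> - {s} = \<rho> then (- 1) ^ sgn_exp \<tau> s else 0)"
proof (cases "\<rho> \<subseteq> \<tau>")
  case True
  have f: "finite \<tau>" "finite \<rho>" using assms binom_finite by blast+
  have "card (\<tau> - \<rho>) = 1" using True assms f by (simp add: card_Diff_subset binom_def)
  then obtain x where x: "\<tau> - \<rho> = {x}" by (auto simp: card_1_singleton_iff)
  have "\<tau> - {s} = \<rho> \<longleftrightarrow> s = x" if "s \<in> \<tau>" for s using that x True by blast
  then have "(\<Sum>s\<in>\<tau>. if \<tau> - {s} = \<rho> then (- 1) ^ sgn_exp \<tau> s else (0::'a))
      = (\<Sum>s\<in>\<tau>. if s = x then (- 1) ^ sgn_exp \<tau> s else 0)" by (intro sum.cong) auto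
  also have "\<dots> = (- 1) ^ sgn_exp \<tau> x" using x f by auto
  finally show ?thesis using True x by (simp add: M_entry_def)
next
  case False
  then have "\<tau> - {s} \<noteq> \<rho>" for s by blast
  then show ?thesis using False by (simp add: M_entry_def)
qed

text \<open>Comparing coefficients in the multidegree of \<open>x\<^sup>m e\<^sub>\<sigma>\<close>, whose exponent is
  \<open>m + expo \<sigma>\<close>.\<close>

lemma koszul_sum_solvable_iff:
  fixes E :: "(nat \<Rightarrow>\<^sub>0 nat) set" and m :: "nat \<Rightarrow>\<^sub>0 nat" and \<sigma> :: "nat set"
  defines "a \<equiv> m + expo \<sigma>"
  assumes I: "I = {f :: 'k::field poly_nat. Poly_Mapping.keys f \<subseteq> E}"
    and m: "Poly_Mapping.keys m \<subseteq> {1..n}" and \<sigma>: "\<sigma> \<in> binom n p"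
  shows "(\<exists>f. (\<forall>\<tau>\<in>binom n (p + 1). f \<tau> \<in> carrier (poly_ring n)) \<and>
      (\<forall>\<rho>. koszul_sum n (p + 1) f \<rho> - (if \<rho> = \<sigma> then Poly_Mapping.single m (1::'k) else 0) \<in> I))
    \<longleftrightarrow> (\<exists>w :: nat set \<Rightarrow> 'k. (\<forall>\<tau>. \<not> \<tau> \<subseteq> Poly_Mapping.keys a \<longrightarrow> w \<tau> = 0) \<and>
      (\<forall>\<rho>\<in>binom n p. \<rho> \<subseteq> Poly_Mapping.keys a \<longrightarrow> \<not> (\<exists>e\<in>E. a = expo \<rho> + e) \<longrightarrow>
        (\<Sum>\<tau>\<in>binom n (p + 1). w \<tau> * M_entry \<rho> \<tau>) = (if \<rho> = \<sigma> then 1 else 0)))"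
    (is "?L \<longleftrightarrow> ?R")
proof -
  let ?A = "Poly_Mapping.keys a"
  have f\<sigma>: "finite \<sigma>" using \<sigma> by (rule binom_finite)
  have \<sigma>A: "\<sigma> \<subseteq> ?A" using f\<sigma> by (simp add: a_def keys_plus_nat keys_expo)
  have a\<sigma>: "b = m" if "a = expo \<sigma> + b" for b using that by (simp add: a_def add.commute)
  have M: "(\<Sum>\<tau>\<in>binom n (p + 1). w \<tau> * M_entry \<rho> \<tau>)
      = (\<Sum>\<tau>\<in>binom n (p + 1). \<Sum>s\<in>\<tau>. if \<tau> - {s} = \<rho> then (- 1) ^ sgn_exp \<tau> s * w \<tau> else 0)"
    if "\<rho> \<in> binom n p" for \<rho> and w :: "nat set \<Rightarrow> 'k"
    by (intro sum.cong refl) (auto simp: M_entry_eq_sum[OF that] sum_distrib_left intro!: sum.cong)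
  show ?thesis
  proof
    assume ?L
    then obtain f where f: "\<And>\<rho>. koszul_sum n (p + 1) f \<rho> - (if \<rho> = \<sigma> then Poly_Mapping.single m (1::'k) else 0) \<in> I"
      by blast
    \<comment> \<open>This is the part of the chain in multidegree \<open>a\<close>. The default
      zero covers those \<tau> for which e_tau does not divide x^a and the truncated difference
      \<open>a - expo \<tau>\<close> has no meaning.\<close>
    define w where "w \<tau> = (if \<tau> \<subseteq> ?A then Poly_Mapping.lookup (f \<tau>) (a - expo \<tau>) else 0)" for \<tau>
    have "(\<Sum>\<tau>\<in>binom n (p + 1). w \<tau> * M_entry \<rho> \<tau>) = (if \<rho> = \<sigma> then 1 else 0)"
      if \<rho>: "\<rho> \<in> binom n p" "\<rho> \<subseteq> ?A" and nE: "\<not> (\<exists>e\<in>E. a = expo \<rho> + e)" for \<rho>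
    proof -
      define b where "b = a - expo \<rho>"
      have ab: "a = expo \<rho> + b" unfolding b_def using binom_finite[OF \<rho>(1)] \<rho>(2) by (rule expo_dvd)
      have lk: "Poly_Mapping.lookup (Var s * f \<tau>) b = w \<tau>"
        if \<tau>: "\<tau> \<in> binom n (p + 1)" and s: "s \<in> \<tau>" "\<tau> - {s} = \<rho>" for \<tau> s
      proof -
        have f\<tau>: "finite \<tau>" using \<tau> by (rule binom_finite)
        have ex: "expo \<tau> = expo \<rho> + Poly_Mapping.single s 1" using expo_remove[OF f\<tau> s(1)] s by simp
        show ?thesis
        proof (cases "\<tau> \<subseteq> ?A")
          case True
          have "expo \<rho> + b = expo \<rho> + (Poly_Mapping.single s 1 + (a - expo \<tau>))"
            using expo_dvd[OF f\<tau> True] ab ex by (metis add.assoc)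
          then have "b = Poly_Mapping.single s 1 + (a - expo \<tau>)" by simp
          then show ?thesis using True by (simp add: Var_def lookup_single_mult w_def)
        next
          case False
          \<comment> \<open>Since \<rho> lies in the support of \<open>a\<close> but \<tau> does
            not, the added vertex \<open>s\<close> is outside it, so x_s cannot divide x^b.\<close>
          have "b \<noteq> Poly_Mapping.single s 1 + k" for k
          proof
            assume "b = Poly_Mapping.single s 1 + k"
            then have "s \<in> ?A" unfolding ab by (simp add: keys_plus_nat)
            then show False using False s \<rho>(2) by blast
          qed
          then show ?thesis using False by (simp add: Var_def lookup_single_mult_eq_0 w_def)
        qed
      qed
      \<comment> \<open>An element of I has coefficient zero at an exponent outside
        \<open>E\<close>; this yields the equation of row \<rho>.\<close>
      have "b \<notin> E" using nE ab by blast
      then have "Poly_Mapping.lookup (koszul_sum n (p + 1) f \<rho> - (if \<rho> = \<sigma> then Poly_Mapping.single m (1::'k) else 0)) b = 0"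
        using f[of \<rho>] unfolding I not_in_keys_iff_lookup_eq_zero[symmetric] by blast
      moreover have "Poly_Mapping.lookup (if \<rho> = \<sigma> then Poly_Mapping.single m (1::'k) else 0) b = (if \<rho> = \<sigma> then 1 else 0)"
        using a\<sigma>[of b] ab by auto
      ultimately have "Poly_Mapping.lookup (koszul_sum n (p + 1) f \<rho>) b = (if \<rho> = \<sigma> then 1 else 0)"
        by (simp only: lookup_minus right_minus_eq)
      moreover have "Poly_Mapping.lookup (koszul_sum n (p + 1) f \<rho>) b
          = (\<Sum>\<tau>\<in>binom n (p + 1). \<Sum>s\<in>\<tau>. if \<tau> - {s} = \<rho> then (- 1) ^ sgn_exp \<tau> s * w \<tau> else 0)"
        unfolding koszul_sum_def lookup_sum
        by (intro sum.cong refl) (simp add: lookup_neg_one_pow_times lk[unfolded Suc_eq_plus1[symmetric]])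
      ultimately show ?thesis unfolding M[OF \<rho>(1)] by simp
    qed
    then show ?R by (intro exI[of _ w] conjI) (simp_all add: w_def)
  next
    assume ?R
    then obtain w :: "nat set \<Rightarrow> 'k" where w0: "\<forall>\<tau>. \<not> \<tau> \<subseteq> ?A \<longrightarrow> w \<tau> = 0"
      and w: "\<forall>\<rho>\<in>binom n p. \<rho> \<subseteq> ?A \<longrightarrow> \<not> (\<exists>e\<in>E. a = expo \<rho> + e) \<longrightarrow>
        (\<Sum>\<tau>\<in>binom n (p + 1). w \<tau> * M_entry \<rho> \<tau>) = (if \<rho> = \<sigma> then 1 else 0)"
      by (elim exE conjE) (rule that)
    \<comment> \<open>The homogeneous chain of multidegree \<open>a\<close> with coefficients
      \<open>w\<close>.\<close>
    define f where "f \<tau> = Poly_Mapping.single (a - expo \<tau>) (w \<tau>)" for \<tau>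
    have an: "?A \<subseteq> {1..n}" using m \<sigma> f\<sigma> by (simp add: a_def keys_plus_nat keys_expo binom_def)
    have "Poly_Mapping.keys (a - expo \<tau>) \<subseteq> ?A" for \<tau>
      by (auto simp: in_keys_iff lookup_minus)
    then have fc: "f \<tau> \<in> carrier (poly_ring n)" for \<tau>
      using an by (auto simp: f_def mem_carrier_poly_ring)
    have tm: "Var s * f \<tau> = Poly_Mapping.single (a - expo (\<tau> - {s})) (w \<tau>)"
      if \<tau>: "\<tau> \<in> binom n (p + 1)" and s: "s \<in> \<tau>" for \<tau> s
    proof (cases "\<tau> \<subseteq> ?A")
      case True
      have f\<tau>: "finite \<tau>" using \<tau> by (rule binom_finite)
      have "expo (\<tau> - {s}) + (a - expo (\<tau> - {s})) = a"
        using f\<tau> True by (intro expo_dvd[symmetric]) auto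
      also have "a = expo (\<tau> - {s}) + (Poly_Mapping.single s 1 + (a - expo \<tau>))"
        using expo_dvd[OF f\<tau> True] expo_remove[OF f\<tau> s] by (metis add.assoc)
      finally show ?thesis by (simp add: f_def Var_def mult_single)
    next
      case False
      then show ?thesis using w0 by (simp add: f_def)
    qed
    \<comment> \<open>The differential preserves multidegree, so all terms at \<rho> are multiples
      of one monomial and their coefficients add up to the row sum.\<close>
    have ks: "koszul_sum n (p + 1) f \<rho> = Poly_Mapping.single (a - expo \<rho>)
        (\<Sum>\<tau>\<in>binom n (p + 1). \<Sum>s\<in>\<tau>. if \<tau> - {s} = \<rho> then (- 1) ^ sgn_exp \<tau> s * w \<tau> else 0)" for \<rho>
      unfolding koszul_sum_def single_sum
    proof (intro sum.cong refl)
      fix \<tau> s assume "\<tau> \<in> binom n (p + 1)" "s \<in> \<tau>"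
      from tm[OF this] show "(if \<tau> - {s} = \<rho> then (- 1) ^ sgn_exp \<tau> s * (Var s * f \<tau>) else 0)
          = Poly_Mapping.single (a - expo \<rho>) (if \<tau> - {s} = \<rho> then (- 1) ^ sgn_exp \<tau> s * w \<tau> else 0)"
        by (auto simp: neg_one_pow_times_single)
    qed
    have "koszul_sum n (p + 1) f \<rho> - (if \<rho> = \<sigma> then Poly_Mapping.single m 1 else 0) \<in> I" for \<rho>
    proof (cases "\<rho> \<in> binom n p \<and> \<rho> \<subseteq> ?A")
      case True
      define b where "b = a - expo \<rho>"
      have ab: "a = expo \<rho> + b" unfolding b_def using binom_finite True by (intro expo_dvd) auto
      define d where "d = (\<Sum>\<tau>\<in>binom n (p + 1). w \<tau> * M_entry \<rho> \<tau>) - (if \<rho> = \<sigma> then 1 else 0)"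
      have kb: "koszul_sum n (p + 1) f \<rho>
          = Poly_Mapping.single b (\<Sum>\<tau>\<in>binom n (p + 1). w \<tau> * M_entry \<rho> \<tau>)"
        unfolding ks M[OF conjunct1[OF True]] b_def ..
      have bm: "b = m" if "\<rho> = \<sigma>" using a\<sigma> ab that by simp
      have "koszul_sum n (p + 1) f \<rho> - (if \<rho> = \<sigma> then Poly_Mapping.single m 1 else 0)
          = Poly_Mapping.single b d"
        unfolding kb d_def single_diff using bm by (simp split: if_split)
      \<comment> \<open>Either the equation of row \<rho> holds exactly, or x^b lies in I and
        absorbs the error \<open>d\<close>.\<close>
      moreover have "d = 0 \<or> b \<in> E"
      proof (rule disjCI)
        assume "b \<notin> E"
        then have nE: "\<not> (\<exists>e\<in>E. a = expo \<rho> + e)" unfolding ab by simp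
        have "\<rho> \<in> binom n p" "\<rho> \<subseteq> ?A" using True by simp_all
        from mp[OF mp[OF bspec[OF w this(1)] this(2)] nE] show "d = 0"
          unfolding d_def right_minus_eq .
      qed
      ultimately show ?thesis by (auto simp: I)
    next
      case False
      then have "\<rho> \<noteq> \<sigma>" using \<sigma> \<sigma>A by blast
      \<comment> \<open>A nonempty contribution forces \<rho> to have size p, hence to leave the
        support of \<open>a\<close>; then \<tau> leaves it too and \<open>w \<tau>\<close> is
        zero.\<close>
      have z: "(if \<tau> - {s} = \<rho> then (- 1) ^ sgn_exp \<tau> s * w \<tau> else 0) = 0"
        if "\<tau> \<in> binom n (p + 1)" "s \<in> \<tau>" for \<tau> s
      proof (cases "\<tau> - {s} = \<rho>")
        case True
        then have "\<rho> \<in> binom n p" using that binom_finite[OF that(1)] by (auto simp: binom_def)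
        then have "\<not> \<tau> \<subseteq> ?A" using True False by blast
        then show ?thesis using w0 by simp
      qed simp
      have "koszul_sum n (p + 1) f \<rho> = Poly_Mapping.single (a - expo \<rho>) 0"
        unfolding ks by (intro arg_cong[where f = "Poly_Mapping.single (a - expo \<rho>)"] sum.neutral ballI z)
      then show ?thesis using \<open>\<rho> \<noteq> \<sigma>\<close> by (simp add: I)
    qed
    then show ?L using fc by blast
  qed
qed

theorem theorem1p1:
  fixes n p :: nat
    and I :: "('k::field) poly_nat set"
    and R :: "'k poly_nat set ring"
    and x :: "nat \<Rightarrow> 'k poly_nat set"
    and js :: "nat list"
    and u :: "'k poly_nat"
  defines "R \<equiv> poly_ring n Quot I"
    and "x \<equiv> (\<lambda>i. residue n I (Var i))"
  assumes "monomial_ideal n I"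
    and "I \<subseteq> ideal_prod (poly_ring n) (irrelevant_ideal n) (irrelevant_ideal n)"
    and "1 \<le> p" and "p \<le> n"
    and "length js = p" and "distinct js" and "set js \<subseteq> {1..n}"
    and "u \<in> monomials n"
    and "scale R (residue n I u) (wedge_list R n js) \<in> koszul_cycles R x n p"
  shows "scale R (residue n I u) (wedge_list R n js) \<in> koszul_boundaries R x n p
    \<longleftrightarrow> u \<in> boundary_ideal n I (set js)"
proof -
  define \<sigma> where "\<sigma> = set js"
  have \<sigma>: "\<sigma> \<in> binom n p" and \<sigma>n: "\<sigma> \<subseteq> {1..n}" and c\<sigma>: "card \<sigma> = p"
    using assms by (auto simp: \<sigma>_def binom_def distinct_card)
  have f\<sigma>: "finite \<sigma>" by (simp add: \<sigma>_def)
  obtain m where u: "u = Poly_Mapping.single m 1" and m: "Poly_Mapping.keys m \<subseteq> {1..n}"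
    using \<open>u \<in> monomials n\<close> by (auto simp: monomials_def)
  have uc: "u \<in> carrier (poly_ring n)" using m by (simp add: u mem_carrier_poly_ring)
  obtain E where E: "I = {f. Poly_Mapping.keys f \<subseteq> E}"
    "\<And>m. m \<in> E \<Longrightarrow> Poly_Mapping.keys m \<subseteq> {1..n}"
    "\<And>m k. m \<in> E \<Longrightarrow> Poly_Mapping.keys k \<subseteq> {1..n} \<Longrightarrow> m + k \<in> E"
    using monomial_ideal_exponents[OF \<open>monomial_ideal n I\<close>] by blast
  interpret poly_ring_ideal n I
    by (rule poly_ring_ideal.intro, subst E(1), rule exponent_ideal[OF E(2,3)])
  have boundary: "scale R (residue n I u) (wedge_list R n js) \<in> koszul_boundaries R x n p \<longleftrightarrow>
      (\<exists>f. (\<forall>\<tau>\<in>binom n (p + 1). f \<tau> \<in> carrier (poly_ring n)) \<and>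
        (\<forall>\<rho>. koszul_sum n (p + 1) f \<rho> - (if \<rho> = \<sigma> then u else 0) \<in> I))"
    using scale_wedge_boundary_iff[OF \<open>distinct js\<close> \<open>set js \<subseteq> {1..n}\<close> uc, of p]
    unfolding R_def x_def \<sigma>_def by simp
  show ?thesis
  proof (cases "p = n")
    case True
    then have full: "\<sigma> = {1..n}" using \<sigma>n c\<sigma> by (simp add: card_subset_eq)
    \<comment> \<open>In top degree there are no chains to take boundaries of, so being a boundary
      means that u vanishes in \<open>R\<close>, in agreement with the convention for the full index
      set.\<close>
    have "binom n (p + 1) = {}"
    proof (rule equals0I)
      fix \<tau> assume "\<tau> \<in> binom n (p + 1)"
      then have "\<tau> \<subseteq> {1..n}" "card \<tau> = n + 1" using True by (simp_all add: binom_def)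
      then show False using card_mono[OF finite_atLeastAtMost, of \<tau> 1 n] by simp
    qed
    then have "koszul_sum n (p + 1) f \<rho> = 0" for f :: "nat set \<Rightarrow> 'k poly_nat" and \<rho>
      by (simp add: koszul_sum_def)
    then have "scale R (residue n I u) (wedge_list R n js) \<in> koszul_boundaries R x n p \<longleftrightarrow> u \<in> I"
      unfolding boundary using \<open>binom n (p + 1) = {}\<close> by (auto simp: E(1) u)
    then show ?thesis using full by (simp add: boundary_ideal_def \<sigma>_def)
  next
    case False
    then have ne: "\<sigma> \<noteq> {1..n}" using c\<sigma> by auto
    let ?a = "m + expo \<sigma>"
    have an: "Poly_Mapping.keys ?a \<subseteq> {1..n}" using m \<sigma>n f\<sigma> by (simp add: keys_plus_nat keys_expo)
    have \<sigma>a: "\<sigma> \<subseteq> Poly_Mapping.keys ?a" using f\<sigma> by (simp add: keys_plus_nat keys_expo)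
    have "scale R (residue n I u) (wedge_list R n js) \<in> koszul_boundaries R x n p \<longleftrightarrow>
        (\<forall>C\<in>circuits TYPE('k) n p. \<sigma> \<in> C \<longrightarrow>
          (\<exists>\<rho>\<in>C. \<rho> \<subseteq> Poly_Mapping.keys ?a \<and> (\<exists>e\<in>E. ?a = expo \<rho> + e)))"
      unfolding boundary unfolding u koszul_sum_solvable_iff[OF E(1) m \<sigma>]
      by (rule solvable_iff_circuits[OF \<open>1 \<le> p\<close> \<sigma> \<sigma>a an])
    also have "\<dots> \<longleftrightarrow> (\<forall>C\<in>circuits TYPE('k) n p. \<sigma> \<in> C \<longrightarrow> u \<in> ideal_sum C (shifted_colon n I \<sigma>))"
    proof (intro ball_cong refl imp_cong)
      fix C assume "C \<in> circuits TYPE('k) n p"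
      then have Csub: "C \<subseteq> binom n p" by (simp add: circuits_def)
      then have C: "finite C" "\<And>\<rho>. \<rho> \<in> C \<Longrightarrow> finite \<rho>"
        using finite_subset[OF Csub] binom_finite by auto
      \<comment> \<open>The containment in the support is implied by the factorization of the
        multidegree, so the circuit criterion and the criterion for the ideal sum coincide.\<close>
      have "\<rho> \<subseteq> Poly_Mapping.keys ?a" if "\<rho> \<in> C" "?a = expo \<rho> + e" for \<rho> e
        unfolding that(2) using C(2)[OF that(1)] by (simp add: keys_plus_nat keys_expo)
      then show "(\<exists>\<rho>\<in>C. \<rho> \<subseteq> Poly_Mapping.keys ?a \<and> (\<exists>e\<in>E. ?a = expo \<rho> + e)) \<longleftrightarrow>
          u \<in> ideal_sum C (shifted_colon n I \<sigma>)"
        using monomial_mem_ideal_sum_iff[OF E(1) f\<sigma> C m] unfolding u by blast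
    qed
    finally show ?thesis
      using ne uc c\<sigma> by (simp add: boundary_ideal_def \<sigma>_def)
  qed
qed

end
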